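(* Let $\mathfrak G$ be a GGS-group over the alphabet $\mathbb Z_m$ with $m\ge2$, with defining data $\Phi$. If $\Phi(k)$ is an isomorphism for some $0\le k\le m-2$, then the Nekrashevych algebra $\mathcal N_K(\mathfrak G,\mathbb Z_m)$ is simple for all fields $K$. Otherwise, $\mathcal N_K(\mathfrak G,\mathbb Z_m)$ is simple over no field $K$. In particular, if $m$ is a prime power, e.g., in the case of Gupta–Sidki $p$-groups, the Nekrashevych algebra is simple over any field.
   Context: For a finite alphabet $X$ with $|X|\ge2$, $X^*$ is the free monoid on $X$. A self-similar group over $X$ is a group $\Gamma$ with a faithful action on $X^*$ by length-preserving permutations such that for all $g\in\Gamma$, $x\in X$ there is $g|_x\in\Gamma$ (the section) with $g(xw)=g(x)\,g|_x(w)$ for all $w\in X^*$. For a field $K$, the Nekrashevych algebra $\mathcal N_K(\Gamma,X)$ is the $*$-algebra over $K$ (with $K$-linear involution satisfying $(ab)^*=b^*a^*$) generated by $X\cup\Gamma$ with relations: $g^*=g^{-1}$ and $g\cdot h=gh$ for $g,h\in\Gamma$; $gx=g(x)g|_x$ for $g\in\Gamma$, $x\in X$; $y^*x=\delta_{x,y}$ for $x,y\in X$; $\sum_{x\in X}xx^*=1$. Simple means nonzero with no two-sided ideals other than $0$ and itself. GGS-groups. $\mathbb Z_m=\{0,1,\dots,m-1\}$ is the integers modulo $m$. Let $m\ge2$, let $G=C_m$ be a cyclic group of order $m$ generated by $t$, and let $H=\mathbb Z_m$ act on the alphabet $X=\mathbb Z_m$ by addition. Let $\Phi(m-1)$ be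 the identity automorphism of $G$ and let $\Phi(k)\in\mathrm{Hom}(G,H)$ for $0\le k\le m-2$; put $e_k=\Phi(k)(t)$ and assume $\gcd(e_0,\dots,e_{m-2},m)=1$. Elements of $H$ and $G$ act on $X^*$ (fixing the empty word) by $h(xw)=(h+x)w$ for $h\in H$, and, for $g\in G$, recursively by $g(xw)=x\,(\Phi(x)(g))(w)$, where $\Phi(x)(g)\in G$ if $x=m-1$ and $\Phi(x)(g)\in H$ otherwise. The corresponding GGS-group $\mathfrak G$ is the (self-similar) group of permutations of $X^*$ generated by these permutations for all $g\in G$, $h\in H$. The Gupta–Sidki $p$-group, $p$ an odd prime, is the case $m=p$, $e_0=1$, $e_1=-1$ and $e_k=0$ for $2\le k\le p-2$. *)

theory Defs
  imports
    "HOL-Algebra.Algebra"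
    "HOL-Library.Poly_Mapping"
    "HOL-Number_Theory.Prime_Powers"
begin

section \<open>Free *-algebras\<close>

text \<open>
  With concatenation as addition, a type of lists is the (additively written) free monoid, so
  that finitely supported functions on lists with the convolution product of
  \<^theory>\<open>HOL-Library.Poly_Mapping\<close> form the free associative algebra.
\<close>

instantiation list :: (type) monoid_add
begin

definition zero_list :: "'a list" where "zero_list = []"
definition plus_list :: "'a list \<Rightarrow> 'a list \<Rightarrow> 'a list" where "plus_list = (@)"

instance by standard (simp_all add: zero_list_def plus_list_def)

end

text \<open>
  The free unital *-algebra on a set \<open>S\<close> is the free associative algebra on \<open>S\<close> together with a
  disjoint formal copy of \<open>S\<close> consisting of the adjoints.
\<close>

datatype 'a starred = Plain 'a | Adj 'a

type_synonym ('a, 'k) free_star = "'a starred list \<Rightarrow>\<^sub>0 'k"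

definition free_star_algebra :: "'k::field itself \<Rightarrow> 'a set \<Rightarrow> ('a, 'k) free_star ring" where
  "free_star_algebra K S =
    \<lparr>carrier = {p. \<forall>w \<in> Poly_Mapping.keys p. set w \<subseteq> Plain ` S \<union> Adj ` S},
     monoid.mult = (*), one = 1, ring.zero = 0, add = (+)\<rparr>"

fun adj :: "'a starred \<Rightarrow> 'a starred" where
  "adj (Plain a) = Adj a"
| "adj (Adj a) = Plain a"

definition adj_word :: "'a starred list \<Rightarrow> 'a starred list" where
  "adj_word w = rev (map adj w)"

text \<open>
  The coefficient of \<open>star p\<close> at \<open>w\<close> is that of \<open>p\<close> at \<open>adj_word w\<close>; since \<^const>\<open>adj_word\<close> is an
  involution, this is the \<open>K\<close>-linear extension of \<^const>\<open>adj_word\<close>.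
\<close>

definition star :: "('a, 'k::field) free_star \<Rightarrow> ('a, 'k) free_star" where
  "star p = Poly_Mapping.map_key adj_word p"

definition gen :: "'a \<Rightarrow> ('a, 'k::field) free_star" where
  "gen a = Poly_Mapping.single [Plain a] 1"

definition presented_star_algebra ::
    "'k::field itself \<Rightarrow> 'a set \<Rightarrow> ('a, 'k) free_star set \<Rightarrow> ('a, 'k) free_star set ring" where
  "presented_star_algebra K S R =
    free_star_algebra K S Quot (Idl\<^bsub>free_star_algebra K S\<^esub> (R \<union> star ` R))"

lemma adj_adj [simp]: "adj (adj a) = a"
  by (cases a) auto

lemma adj_word_adj_word [simp]: "adj_word (adj_word w) = w"
  by (simp add: adj_word_def rev_map comp_def)

lemma inj_adj_word: "inj adj_word"
  by (metis adj_word_adj_word injI)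

lemma lookup_star: "Poly_Mapping.lookup (star p) w = Poly_Mapping.lookup p (adj_word w)"
  by (simp add: star_def map_key.rep_eq inj_adj_word)

lemma star_star [simp]: "star (star p) = p"
  by (rule poly_mapping_eqI) (simp add: lookup_star)

lemma star_add: "star (p + q) = star p + star q"
  by (rule poly_mapping_eqI) (simp add: lookup_star lookup_add)

lemma star_single: "star (Poly_Mapping.single w c) = Poly_Mapping.single (adj_word w) c"
  by (rule poly_mapping_eqI) (auto simp: lookup_star lookup_single when_def)

lemma adj_word_plus: "adj_word (v + w) = adj_word w + adj_word v"
  by (simp add: adj_word_def plus_list_def)

lemma free_star_induct [case_names zero single]:
  fixes p :: "('a, 'k::field) free_star"
  assumes "P 0" "\<And>w c p. P p \<Longrightarrow> P (p + Poly_Mapping.single w c)"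
  shows "P p"
proof (induction p rule: update_induct)
  case (update p w c)
  have "Poly_Mapping.update w c p = p + Poly_Mapping.single w c"
    using update(1)
    by (intro poly_mapping_eqI) (auto simp: lookup_update lookup_add lookup_single in_keys_iff when_def)
  then show ?case
    using assms(2) update by simp
qed (rule assms)

lemma star_zero [simp]: "star 0 = 0"
  by (rule poly_mapping_eqI) (simp add: lookup_star)

lemma star_uminus: "star (- p) = - star p"
  by (rule poly_mapping_eqI) (simp add: lookup_star)

lemma star_mult: "star (p * q) = star q * star p"
proof -
  have single: "star (Poly_Mapping.single v c * q) = star q * star (Poly_Mapping.single v c)" for v c
    by (induction q rule: free_star_induct)
       (simp_all add: star_add star_single mult_single adj_word_plus mult.commute distrib_left distrib_right)
  show ?thesis
    by (induction p rule: free_star_induct)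
       (simp_all add: single star_add distrib_left distrib_right)
qed

lemma carrier_free_star_algebra:
  "p \<in> carrier (free_star_algebra K S) \<longleftrightarrow>
    (\<forall>w \<in> Poly_Mapping.keys p. set w \<subseteq> Plain ` S \<union> Adj ` S)"
  by (simp add: free_star_algebra_def)

lemma free_star_algebra_simps [simp]:
  "monoid.mult (free_star_algebra K S) = (*)" "one (free_star_algebra K S) = 1"
  "ring.zero (free_star_algebra K S) = 0" "add (free_star_algebra K S) = (+)"
  by (simp_all add: free_star_algebra_def)

lemma free_star_algebra_closed:
  shows "1 \<in> carrier (free_star_algebra K S)"
    and "0 \<in> carrier (free_star_algebra K S)"
    and "p \<in> carrier (free_star_algebra K S) \<Longrightarrow> - p \<in> carrier (free_star_algebra K S)"
    and "p \<in> carrier (free_star_algebra K S) \<Longrightarrow> q \<in> carrier (free_star_algebra K S)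
      \<Longrightarrow> p + q \<in> carrier (free_star_algebra K S)"
    and "p \<in> carrier (free_star_algebra K S) \<Longrightarrow> q \<in> carrier (free_star_algebra K S)
      \<Longrightarrow> p - q \<in> carrier (free_star_algebra K S)"
    and "p \<in> carrier (free_star_algebra K S) \<Longrightarrow> q \<in> carrier (free_star_algebra K S)
      \<Longrightarrow> p * q \<in> carrier (free_star_algebra K S)"
    and "p \<in> carrier (free_star_algebra K S) \<Longrightarrow> star p \<in> carrier (free_star_algebra K S)"
proof -
  show "p \<in> carrier (free_star_algebra K S) \<Longrightarrow> q \<in> carrier (free_star_algebra K S)
      \<Longrightarrow> p + q \<in> carrier (free_star_algebra K S)"
    using keys_add[of p q] unfolding carrier_free_star_algebra by blast
  show "p \<in> carrier (free_star_algebra K S) \<Longrightarrow> q \<in> carrier (free_star_algebra K S)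
      \<Longrightarrow> p - q \<in> carrier (free_star_algebra K S)"
    using keys_diff[of p q] unfolding carrier_free_star_algebra by blast
  show "p * q \<in> carrier (free_star_algebra K S)"
    if p: "p \<in> carrier (free_star_algebra K S)" and q: "q \<in> carrier (free_star_algebra K S)"
    unfolding carrier_free_star_algebra
  proof
    fix w assume "w \<in> Poly_Mapping.keys (p * q)"
    then obtain u v where w: "w = u + v" "u \<in> Poly_Mapping.keys p" "v \<in> Poly_Mapping.keys q"
      using keys_mult[of p q] by blast
    have "set w = set u \<union> set v"
      by (simp add: w(1) plus_list_def)
    with w p q show "set w \<subseteq> Plain ` S \<union> Adj ` S"
      unfolding carrier_free_star_algebra by blast
  qed
  show "star p \<in> carrier (free_star_algebra K S)" if "p \<in> carrier (free_star_algebra K S)"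
    unfolding carrier_free_star_algebra
  proof
    fix w assume "w \<in> Poly_Mapping.keys (star p)"
    then have "adj_word w \<in> Poly_Mapping.keys p"
      by (simp add: in_keys_iff lookup_star)
    with that have "set (adj_word w) \<subseteq> Plain ` S \<union> Adj ` S"
      unfolding carrier_free_star_algebra by blast
    then have "adj ` set w \<subseteq> Plain ` S \<union> Adj ` S"
      by (simp add: adj_word_def)
    then have "adj ` adj ` set w \<subseteq> adj ` (Plain ` S \<union> Adj ` S)"
      by (rule image_mono)
    then show "set w \<subseteq> Plain ` S \<union> Adj ` S"
      by (simp add: image_image image_Un Un_commute)
  qed
qed (simp_all add: carrier_free_star_algebra zero_list_def)

lemma ring_free_star_algebra: "ring (free_star_algebra K S)"
proof (rule ringI)
  show "abelian_group (free_star_algebra K S)"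
  proof (rule abelian_groupI)
    fix p assume "p \<in> carrier (free_star_algebra K S)"
    then show "\<exists>q \<in> carrier (free_star_algebra K S). q \<oplus>\<^bsub>free_star_algebra K S\<^esub> p = \<zero>\<^bsub>free_star_algebra K S\<^esub>"
      by (intro bexI[of _ "- p"]) (simp_all add: free_star_algebra_closed)
  qed (simp_all add: free_star_algebra_closed add_ac)
  show "monoid (free_star_algebra K S)"
    by (rule monoidI) (simp_all add: free_star_algebra_closed mult.assoc)
qed (simp_all add: distrib_left distrib_right)

text \<open>The relators are closed off under the involution, hence so is the ideal they generate:\<close>

lemma star_closed_ideal:
  fixes R :: "('a, 'k::field) free_star set" and K :: "'k itself" and S :: "'a set"
  defines "F \<equiv> free_star_algebra K S"
  assumes R: "R \<subseteq> carrier F" and p: "p \<in> Idl\<^bsub>F\<^esub> (R \<union> star ` R)"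
  shows "star p \<in> Idl\<^bsub>F\<^esub> (R \<union> star ` R)"
proof -
  interpret F: ring F
    unfolding F_def by (rule ring_free_star_algebra)
  note closed = free_star_algebra_closed[where K = K and S = S, folded F_def]
  note simps = free_star_algebra_simps[where K = K and S = S, folded F_def]
  have sub: "R \<union> star ` R \<subseteq> carrier F"
    using R closed(7) by blast
  interpret I: ideal "Idl\<^bsub>F\<^esub> (R \<union> star ` R)" F
    by (rule F.genideal_ideal[OF sub])
  let ?J = "{q \<in> carrier F. star q \<in> Idl\<^bsub>F\<^esub> (R \<union> star ` R)}"
  have a_inv: "\<ominus>\<^bsub>F\<^esub> q = - q" if "q \<in> carrier F" for q
    using that by (intro F.minus_equality) (simp_all add: simps closed)
  have "ideal ?J F"
  proof (rule idealI)
    show "ring F" by (rule F.ring_axioms)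
    show "subgroup ?J (add_monoid F)"
    proof (rule F.add.subgroupI)
      have "star 0 \<in> Idl\<^bsub>F\<^esub> (R \<union> star ` R)"
        using I.zero_closed by (simp add: simps)
      then show "?J \<noteq> {}"
        using closed(2) by blast
      fix q assume q: "q \<in> ?J"
      then have "- star q \<in> Idl\<^bsub>F\<^esub> (R \<union> star ` R)"
        using I.a_inv_closed[of "star q"] a_inv[of "star q"] closed(7)[of q] by simp
      with q show "\<ominus>\<^bsub>F\<^esub> q \<in> ?J"
        by (simp add: a_inv closed star_uminus)
      fix r assume r: "r \<in> ?J"
      then show "q \<oplus>\<^bsub>F\<^esub> r \<in> ?J"
        using q I.a_closed[of "star q" "star r"] by (simp add: simps closed star_add)
    qed auto
  next
    fix q x assume "q \<in> ?J" "x \<in> carrier F"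
    then show "x \<otimes>\<^bsub>F\<^esub> q \<in> ?J" "q \<otimes>\<^bsub>F\<^esub> x \<in> ?J"
      using I.I_r_closed[of "star q" "star x"] I.I_l_closed[of "star q" "star x"]
      by (simp_all add: simps closed star_mult)
  qed
  moreover have "R \<union> star ` R \<subseteq> ?J"
    using sub F.genideal_self[OF sub] by auto
  ultimately have "Idl\<^bsub>F\<^esub> (R \<union> star ` R) \<subseteq> ?J"
    by (rule F.genideal_minimal)
  with p show ?thesis by blast
qed

section \<open>Self-similar groups and Nekrashevych algebras\<close>

text \<open>
  The action being faithful, a self-similar group is identified with a group of permutations of
  the set of words. These are taken from \<^const>\<open>BijGroup\<close>, hence undefined outside
  \<^term>\<open>lists A\<close>.
\<close>

locale self_similar_group =
  fixes A :: "'x set" and \<Gamma> :: "('x list \<Rightarrow> 'x list) set"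
  assumes finite_alphabet: "finite A" and card_alphabet: "2 \<le> card A"
    and subgroup_perms: "subgroup \<Gamma> (BijGroup (lists A))"
    and length_preserving: "\<lbrakk>g \<in> \<Gamma>; w \<in> lists A\<rbrakk> \<Longrightarrow> length (g w) = length w"
    and section_exists: "\<lbrakk>g \<in> \<Gamma>; x \<in> A\<rbrakk> \<Longrightarrow> \<exists>h\<in>\<Gamma>. \<forall>w\<in>lists A. g (x # w) = g [x] @ h w"

definition group_section ::
    "'x set \<Rightarrow> ('x list \<Rightarrow> 'x list) set \<Rightarrow> ('x list \<Rightarrow> 'x list) \<Rightarrow> 'x \<Rightarrow> ('x list \<Rightarrow> 'x list)" where
  "group_section A \<Gamma> g x = (THE h. h \<in> \<Gamma> \<and> (\<forall>w\<in>lists A. g (x # w) = g [x] @ h w))"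

datatype 'x nek_gen = Letter 'x | Elem "'x list \<Rightarrow> 'x list"

text \<open>
  The relation identifying the neutral element of the group with the unit of the algebra is
  implicit in the requirement that \<open>\<Gamma>\<close> acts by unitaries. It does not follow from the other
  relations, which are also satisfied when all group elements are sent to \<open>0\<close>.
\<close>

definition nek_relators ::
    "'x set \<Rightarrow> ('x list \<Rightarrow> 'x list) set \<Rightarrow> ('x nek_gen, 'k::field) free_star set" where
  "nek_relators A \<Gamma> =
     {gen (Elem \<one>\<^bsub>BijGroup (lists A)\<^esub>) - 1}
   \<union> {star (gen (Elem g)) - gen (Elem (inv\<^bsub>BijGroup (lists A)\<^esub> g)) | g. g \<in> \<Gamma>}
   \<union> {gen (Elem g) * gen (Elem h) - gen (Elem (g \<otimes>\<^bsub>BijGroup (lists A)\<^esub> h)) | g h. g \<in> \<Gamma> \<and> h \<in> \<Gamma>}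
   \<union> {gen (Elem g) * gen (Letter x) - gen (Letter (hd (g [x]))) * gen (Elem (group_section A \<Gamma> g x))
        | g x. g \<in> \<Gamma> \<and> x \<in> A}
   \<union> {star (gen (Letter y)) * gen (Letter x) - (if x = y then 1 else 0) | x y. x \<in> A \<and> y \<in> A}
   \<union> {(\<Sum>x\<in>A. gen (Letter x) * star (gen (Letter x))) - 1}"

definition nekrashevych_algebra ::
    "'k::field itself \<Rightarrow> 'x set \<Rightarrow> ('x list \<Rightarrow> 'x list) set \<Rightarrow> ('x nek_gen, 'k) free_star set ring" where
  "nekrashevych_algebra K A \<Gamma> =
    presented_star_algebra K (Letter ` A \<union> Elem ` \<Gamma>) (nek_relators A \<Gamma>)"

lemma (in self_similar_group) group_section_in:
  assumes g: "g \<in> \<Gamma>" and x: "x \<in> A"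
  shows "group_section A \<Gamma> g x \<in> \<Gamma>"
proof -
  have "\<exists>!h. h \<in> \<Gamma> \<and> (\<forall>w\<in>lists A. g (x # w) = g [x] @ h w)"
  proof (rule ex_ex1I)
    show "\<exists>h. h \<in> \<Gamma> \<and> (\<forall>w\<in>lists A. g (x # w) = g [x] @ h w)"
      using section_exists[OF g x] by blast
  next
    fix h h'
    assume *: "h \<in> \<Gamma> \<and> (\<forall>w\<in>lists A. g (x # w) = g [x] @ h w)"
      "h' \<in> \<Gamma> \<and> (\<forall>w\<in>lists A. g (x # w) = g [x] @ h' w)"
    then have "h \<in> \<Gamma>" "h' \<in> \<Gamma>"
      by blast+
    then have "h \<in> extensional (lists A)" "h' \<in> extensional (lists A)"
      using subgroup.subset[OF subgroup_perms] by (auto simp: BijGroup_def Bij_def)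
    moreover have "h w = h' w" if "w \<in> lists A" for w
    proof -
      from * that have "g (x # w) = g [x] @ h w" "g (x # w) = g [x] @ h' w"
        by blast+
      then show ?thesis by simp
    qed
    ultimately show "h = h'"
      by (rule extensionalityI)
  qed
  from theI'[OF this] show ?thesis
    unfolding group_section_def by blast
qed

lemma (in self_similar_group) nek_relators_carrier:
  "nek_relators A \<Gamma> \<subseteq> carrier (free_star_algebra K (Letter ` A \<union> Elem ` \<Gamma>))"
proof -
  let ?F = "free_star_algebra K (Letter ` A \<union> Elem ` \<Gamma>)"
  interpret subgroup \<Gamma> "BijGroup (lists A)"
    by (rule subgroup_perms)
  have letter: "gen (Letter x) \<in> carrier ?F" if "x \<in> A" for x
    using that by (simp add: carrier_free_star_algebra gen_def)
  have elem: "gen (Elem g) \<in> carrier ?F" if "g \<in> \<Gamma>" for g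
    using that by (simp add: carrier_free_star_algebra gen_def)
  have hd: "hd (g [x]) \<in> A" if "g \<in> \<Gamma>" "x \<in> A" for g x
  proof -
    have "g \<in> Bij (lists A)"
      using subset that(1) by (auto simp: BijGroup_def)
    then have "g \<in> lists A \<rightarrow> lists A"
      by (rule Bij_imp_funcset)
    with that have "g [x] \<in> lists A" "length (g [x]) = 1"
      using length_preserving[of g "[x]"] by auto
    then show ?thesis
      by (cases "g [x]") auto
  qed
  have sum: "(\<Sum>x\<in>B. gen (Letter x) * star (gen (Letter x))) \<in> carrier ?F" if "B \<subseteq> A" for B
    using finite_subset[OF that finite_alphabet] that
    by (induction B rule: finite_induct) (auto simp: free_star_algebra_closed letter)
  show ?thesis
    unfolding nek_relators_def
    by (auto intro!: free_star_algebra_closed letter elem hd sum group_section_in)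
qed

lemma (in self_similar_group) ring_nekrashevych_algebra: "ring (nekrashevych_algebra K A \<Gamma>)"
proof -
  let ?F = "free_star_algebra K (Letter ` A \<union> Elem ` \<Gamma>)"
  interpret F: ring ?F
    by (rule ring_free_star_algebra)
  have "nek_relators A \<Gamma> \<union> star ` nek_relators A \<Gamma> \<subseteq> carrier ?F"
    using nek_relators_carrier[of K] by (auto intro: free_star_algebra_closed)
  then show ?thesis
    unfolding nekrashevych_algebra_def presented_star_algebra_def
    by (intro ideal.quotient_is_ring F.genideal_ideal)
qed

text \<open>In a unital algebra, every two-sided ring ideal is a linear subspace.\<close>

definition simple_ring :: "('a, 'b) ring_scheme \<Rightarrow> bool" where
  "simple_ring R \<longleftrightarrow> ring R \<and> carrier R \<noteq> {\<zero>\<^bsub>R\<^esub>} \<and>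
     (\<forall>I. ideal I R \<longrightarrow> I = {\<zero>\<^bsub>R\<^esub>} \<or> I = carrier R)"

section \<open>GGS-groups\<close>

fun act_H :: "nat \<Rightarrow> int \<Rightarrow> int list \<Rightarrow> int list" where
  "act_H m h [] = []"
| "act_H m h (x # w) = (h \<otimes>\<^bsub>integer_mod_group m\<^esub> x) # w"

text \<open>
  Only the values of \<open>\<Phi>\<close> at \<open>0, \<dots>, m - 2\<close> are used; \<open>\<Phi>(m - 1)\<close>, which is the identity of the group
  acted by, is built into the recursion.
\<close>

fun act_G :: "nat \<Rightarrow> (int \<Rightarrow> 'g \<Rightarrow> int) \<Rightarrow> 'g \<Rightarrow> int list \<Rightarrow> int list" where
  "act_G m \<Phi> g [] = []"
| "act_G m \<Phi> g (x # w) = x # (if x = int m - 1 then act_G m \<Phi> g w else act_H m (\<Phi> x g) w)"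

locale ggs_data = group G for G :: "('g, 'b) monoid_scheme" (structure) +
  fixes m :: nat and t :: 'g and \<Phi> :: "int \<Rightarrow> 'g \<Rightarrow> int"
  assumes m_ge_2: "2 \<le> m"
    and order_G: "order G = m"
    and generator: "t \<in> carrier G" "generate G {t} = carrier G"
    and Phi_hom: "k \<in> {0..int m - 2} \<Longrightarrow> \<Phi> k \<in> hom G (integer_mod_group m)"
    and gcd_1: "Gcd (insert (int m) ((\<lambda>k. \<Phi> k t) ` {0..int m - 2})) = 1"

definition ggs_group ::
    "('g, 'b) monoid_scheme \<Rightarrow> nat \<Rightarrow> (int \<Rightarrow> 'g \<Rightarrow> int) \<Rightarrow> (int list \<Rightarrow> int list) set" where
  "ggs_group G m \<Phi> =
    (let W = lists (carrier (integer_mod_group m))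
     in generate (BijGroup W)
          ((\<lambda>g. restrict (act_G m \<Phi> g) W) ` carrier G \<union>
           (\<lambda>h. restrict (act_H m h) W) ` carrier (integer_mod_group m)))"

context ggs_data
begin

abbreviation "Z \<equiv> integer_mod_group m"
abbreviation "W \<equiv> lists (carrier Z)"

lemma act_H_closed: "h \<in> carrier Z \<Longrightarrow> w \<in> W \<Longrightarrow> act_H m h w \<in> W"
  using monoid.m_closed[OF group.is_monoid[OF group_integer_mod_group[of m]]] by (cases w) auto

lemma Phi_closed: "\<lbrakk>g \<in> carrier G; x \<in> carrier Z; x \<noteq> int m - 1\<rbrakk> \<Longrightarrow> \<Phi> x g \<in> carrier Z"
  using Phi_hom[of x] m_ge_2 by (auto simp: hom_def carrier_integer_mod_group)

lemma Phi_mult: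
  "\<lbrakk>g \<in> carrier G; h \<in> carrier G; x \<in> carrier Z; x \<noteq> int m - 1\<rbrakk>
    \<Longrightarrow> \<Phi> x (g \<otimes> h) = \<Phi> x g \<otimes>\<^bsub>Z\<^esub> \<Phi> x h"
  using Phi_hom[of x] m_ge_2 by (auto simp: hom_def carrier_integer_mod_group)

lemma Phi_one: "\<lbrakk>x \<in> carrier Z; x \<noteq> int m - 1\<rbrakk> \<Longrightarrow> \<Phi> x \<one> = \<one>\<^bsub>Z\<^esub>"
  using Phi_hom[of x] m_ge_2
  by (intro hom_one[OF _ is_group group_integer_mod_group]) (auto simp: carrier_integer_mod_group)

lemma act_G_closed: "g \<in> carrier G \<Longrightarrow> w \<in> W \<Longrightarrow> act_G m \<Phi> g w \<in> W"
  by (induction w) (auto simp: Phi_closed act_H_closed)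

lemma act_H_mult:
  "\<lbrakk>h \<in> carrier Z; k \<in> carrier Z; w \<in> W\<rbrakk> \<Longrightarrow> act_H m (h \<otimes>\<^bsub>Z\<^esub> k) w = act_H m h (act_H m k w)"
  by (cases w) (simp_all add: mod_simps add.assoc)

lemma act_G_mult:
  "\<lbrakk>g \<in> carrier G; h \<in> carrier G; w \<in> W\<rbrakk> \<Longrightarrow> act_G m \<Phi> (g \<otimes> h) w = act_G m \<Phi> g (act_G m \<Phi> h w)"
  by (induction w) (simp_all add: Phi_mult Phi_closed act_H_mult del: mult_integer_mod_group)

lemma act_H_one: "w \<in> W \<Longrightarrow> act_H m \<one>\<^bsub>Z\<^esub> w = w"
  using m_ge_2 by (cases w) (auto simp: carrier_integer_mod_group)

lemma act_G_one: "w \<in> W \<Longrightarrow> act_G m \<Phi> \<one> w = w"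
  by (induction w) (simp_all add: Phi_one act_H_one del: one_integer_mod_group)

lemma length_act_H: "length (act_H m h w) = length w"
  by (cases w) auto

lemma length_act_G: "length (act_G m \<Phi> g w) = length w"
  by (induction w) (auto simp: length_act_H)

lemma restrict_BijGroup:
  assumes "\<And>w. w \<in> W \<Longrightarrow> f w \<in> W" "\<And>w. w \<in> W \<Longrightarrow> f' w \<in> W"
    and "\<And>w. w \<in> W \<Longrightarrow> f' (f w) = w" "\<And>w. w \<in> W \<Longrightarrow> f (f' w) = w"
  shows "restrict f W \<in> carrier (BijGroup W)"
    and "inv\<^bsub>BijGroup W\<^esub> (restrict f W) = restrict f' W"
proof -
  have "bij_betw f W W"
    by (rule bij_betw_byWitness[where f' = f']) (use assms in auto)
  moreover have "bij_betw f' W W"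
    by (rule bij_betw_byWitness[where f' = f]) (use assms in auto)
  ultimately have Bij: "restrict f W \<in> Bij W" "restrict f' W \<in> Bij W"
    by (simp_all add: Bij_def)
  then show "restrict f W \<in> carrier (BijGroup W)"
    by (simp add: BijGroup_def)
  have "compose W (restrict f' W) (restrict f W) = restrict (\<lambda>w. w) W"
    using assms(1,3) by (intro extensionalityI[where A = W]) (simp_all add: compose_def)
  with Bij show "inv\<^bsub>BijGroup W\<^esub> (restrict f W) = restrict f' W"
    by (intro group.inv_equality[OF group_BijGroup]) (simp_all add: BijGroup_def)
qed

lemma perm_G:
  assumes "g \<in> carrier G"
  shows "restrict (act_G m \<Phi> g) W \<in> carrier (BijGroup W)"
    and "inv\<^bsub>BijGroup W\<^esub> (restrict (act_G m \<Phi> g) W) = restrict (act_G m \<Phi> (inv g)) W"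
  using assms restrict_BijGroup[of "act_G m \<Phi> g" "act_G m \<Phi> (inv g)"]
  by (simp_all add: act_G_closed act_G_mult[symmetric] act_G_one)

lemma perm_H:
  assumes "h \<in> carrier Z"
  shows "restrict (act_H m h) W \<in> carrier (BijGroup W)"
    and "inv\<^bsub>BijGroup W\<^esub> (restrict (act_H m h) W) = restrict (act_H m (inv\<^bsub>Z\<^esub> h)) W"
proof -
  interpret Z: group Z by simp
  show "restrict (act_H m h) W \<in> carrier (BijGroup W)"
    "inv\<^bsub>BijGroup W\<^esub> (restrict (act_H m h) W) = restrict (act_H m (inv\<^bsub>Z\<^esub> h)) W"
    using assms restrict_BijGroup[of "act_H m h" "act_H m (inv\<^bsub>Z\<^esub> h)"]
    by (simp_all add: act_H_closed act_H_mult[symmetric] act_H_one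
        del: mult_integer_mod_group inv_integer_mod_group one_integer_mod_group)
qed

definition gens where
  "gens = (\<lambda>g. restrict (act_G m \<Phi> g) W) ` carrier G \<union> (\<lambda>h. restrict (act_H m h) W) ` carrier Z"

lemma ggs_group_eq: "ggs_group G m \<Phi> = generate (BijGroup W) gens"
  by (simp add: ggs_group_def gens_def Let_def)

lemma gens_subset: "gens \<subseteq> carrier (BijGroup W)"
  using perm_G(1) perm_H(1) unfolding gens_def by blast

lemma inv_gens: "f \<in> gens \<Longrightarrow> inv\<^bsub>BijGroup W\<^esub> f \<in> gens"
proof -
  interpret Z: group Z by simp
  assume "f \<in> gens"
  then consider g where "g \<in> carrier G" "f = restrict (act_G m \<Phi> g) W"
    | h where "h \<in> carrier Z" "f = restrict (act_H m h) W"
    unfolding gens_def by blast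
  then show ?thesis
  proof cases
    case 1
    then show ?thesis using inv_closed perm_G(2) unfolding gens_def by blast
  next
    case 2
    then show ?thesis using Z.inv_closed perm_H(2) unfolding gens_def by blast
  qed
qed

lemma gens_length: "f \<in> gens \<Longrightarrow> w \<in> W \<Longrightarrow> length (f w) = length w"
  by (auto simp: gens_def length_act_G length_act_H)

lemma gens_section:
  assumes f: "f \<in> gens" and x: "x \<in> carrier Z"
  shows "\<exists>h \<in> generate (BijGroup W) gens. \<forall>w\<in>W. f (x # w) = f [x] @ h w"
proof -
  have one: "restrict (\<lambda>w. w) W \<in> generate (BijGroup W) gens"
    using generate.one[of "BijGroup W" gens] by (simp add: BijGroup_def)
  from f consider g where "g \<in> carrier G" "f = restrict (act_G m \<Phi> g) W"
    | h where "h \<in> carrier Z" "f = restrict (act_H m h) W"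
    unfolding gens_def by blast
  then show ?thesis
  proof cases
    case (1 g)
    let ?h = "restrict (if x = int m - 1 then act_G m \<Phi> g else act_H m (\<Phi> x g)) W"
    have "?h \<in> gens"
      using 1(1) Phi_closed[OF 1(1) x] by (auto simp: gens_def)
    moreover have "\<forall>w\<in>W. f (x # w) = f [x] @ ?h w"
      using x by (simp add: 1(2))
    ultimately show ?thesis by (blast intro: generate.incl)
  next
    case (2 h)
    have "\<forall>w\<in>W. f (x # w) = f [x] @ restrict (\<lambda>w. w) W w"
      using x by (simp add: 2(2))
    with one show ?thesis by blast
  qed
qed

definition has_section where
  "has_section f x \<longleftrightarrow> (\<exists>h \<in> generate (BijGroup W) gens. \<forall>w\<in>W. f (x # w) = f [x] @ h w)"

lemma generate_Bij:
  assumes "f \<in> generate (BijGroup W) gens"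
  shows "f \<in> Bij W"
proof -
  have "f \<in> carrier (BijGroup W)"
    by (rule group.generate_in_carrier[OF group_BijGroup gens_subset assms])
  then show ?thesis by (simp add: BijGroup_def)
qed

lemma generate_mult:
  assumes "f \<in> generate (BijGroup W) gens" "k \<in> generate (BijGroup W) gens" "w \<in> W"
  shows "(f \<otimes>\<^bsub>BijGroup W\<^esub> k) w = f (k w)"
proof -
  have "f \<in> Bij W" "k \<in> Bij W"
    using assms by (blast intro: generate_Bij)+
  with assms(3) show ?thesis
    by (simp add: BijGroup_def compose_def)
qed

lemma generate_closed: "\<lbrakk>f \<in> generate (BijGroup W) gens; w \<in> W\<rbrakk> \<Longrightarrow> f w \<in> W"
  by (rule funcset_mem[OF Bij_imp_funcset[OF generate_Bij]])

lemma one_BijGroup: "w \<in> W \<Longrightarrow> \<one>\<^bsub>BijGroup W\<^esub> w = w"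
  by (simp add: BijGroup_def)

lemma generate_length:
  "f \<in> generate (BijGroup W) gens \<Longrightarrow> w \<in> W \<Longrightarrow> length (f w) = length w"
proof (induction f arbitrary: w rule: generate.induct)
  case (eng f k)
  then show ?case by (simp only: generate_mult generate_closed)
qed (simp_all only: one_BijGroup gens_length inv_gens)

lemma generate_section:
  "f \<in> generate (BijGroup W) gens \<Longrightarrow> x \<in> carrier Z \<Longrightarrow> has_section f x"
proof (induction f arbitrary: x rule: generate.induct)
  case one
  show ?case
    unfolding has_section_def
  proof (rule bexI)
    show "\<forall>w\<in>W. \<one>\<^bsub>BijGroup W\<^esub> (x # w) = \<one>\<^bsub>BijGroup W\<^esub> [x] @ \<one>\<^bsub>BijGroup W\<^esub> w"
      using one by (simp add: one_BijGroup)
  qed (rule generate.one)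
next
  case (incl f)
  then show ?case unfolding has_section_def by (rule gens_section)
next
  case (inv f)
  then show ?case unfolding has_section_def by (intro gens_section inv_gens)
next
  case (eng f k)
  have xW: "[x] \<in> W" using eng.prems by simp
  obtain h where h: "h \<in> generate (BijGroup W) gens" "\<And>w. w \<in> W \<Longrightarrow> k (x # w) = k [x] @ h w"
    using eng.IH(2)[OF eng.prems] unfolding has_section_def by blast
  have "length (k [x]) = Suc 0"
    using generate_length[OF eng.hyps(2) xW] by simp
  then obtain y where y: "k [x] = [y]"
    by (auto simp: length_Suc_conv)
  then have "y \<in> carrier Z"
    using generate_closed[OF eng.hyps(2) xW] by simp
  from eng.IH(1)[OF this]
  obtain h' where h': "h' \<in> generate (BijGroup W) gens" "\<And>w. w \<in> W \<Longrightarrow> f (y # w) = f [y] @ h' w"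
    unfolding has_section_def by blast
  have "(f \<otimes>\<^bsub>BijGroup W\<^esub> k) (x # w) = (f \<otimes>\<^bsub>BijGroup W\<^esub> k) [x] @ (h' \<otimes>\<^bsub>BijGroup W\<^esub> h) w"
    if w: "w \<in> W" for w
  proof -
    have xwW: "x # w \<in> W" using eng.prems w by simp
    have "(f \<otimes>\<^bsub>BijGroup W\<^esub> k) (x # w) = f (k (x # w))"
      by (rule generate_mult[OF eng.hyps xwW])
    also have "\<dots> = f (y # h w)"
      by (simp only: h(2)[OF w] y append.simps)
    also have "\<dots> = f [y] @ h' (h w)"
      by (rule h'(2)[OF generate_closed[OF h(1) w]])
    also have "\<dots> = (f \<otimes>\<^bsub>BijGroup W\<^esub> k) [x] @ (h' \<otimes>\<^bsub>BijGroup W\<^esub> h) w"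
      by (simp only: generate_mult[OF eng.hyps xW] generate_mult[OF h'(1) h(1) w] y)
    finally show ?thesis .
  qed
  then show ?case
    unfolding has_section_def using generate.eng[OF h'(1) h(1)] by blast
qed

lemma self_similar_ggs_group: "self_similar_group (carrier Z) (ggs_group G m \<Phi>)"
  unfolding ggs_group_eq
proof (rule self_similar_group.intro)
  show "finite (carrier Z)" "2 \<le> card (carrier Z)"
    using m_ge_2 by (simp_all add: carrier_integer_mod_group)
  show "subgroup (generate (BijGroup W) gens) (BijGroup W)"
    by (rule group.generate_is_subgroup[OF group_BijGroup gens_subset])
  show "length (g w) = length w" if "g \<in> generate (BijGroup W) gens" "w \<in> W" for g w
    by (rule generate_length[OF that])
  show "\<exists>h\<in>generate (BijGroup W) gens. \<forall>w\<in>W. g (x # w) = g [x] @ h w"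
    if "g \<in> generate (BijGroup W) gens" "x \<in> carrier Z" for g x
    by (rule generate_section[OF that, unfolded has_section_def])
qed

end

definition gupta_sidki_data :: "nat \<Rightarrow> 'g \<Rightarrow> (int \<Rightarrow> 'g \<Rightarrow> int) \<Rightarrow> bool" where
  "gupta_sidki_data m t \<Phi> \<longleftrightarrow> Factorial_Ring.prime m \<and> odd m \<and>
     \<Phi> 0 t = 1 \<and> \<Phi> 1 t = (- 1) mod int m \<and> (\<forall>k \<in> {2..int m - 2}. \<Phi> k t = 0)"

end

theory Submission
  imports Defs "HOL-Library.Sublist"
begin

text \<open>
  Write \<open>x\<^sub>k\<close> for the letters, \<open>e\<^sub>k = \<Phi> k t\<close>, and call two ways of acting on words equal near
  \<open>c\<^sup>\<infinity>\<close> if they agree on all words that start with \<open>c\<^sup>n\<close>, for some \<open>n\<close>. The ideals of the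
  algebra correspond to those of the free algebra that contain the relators.

  \<^emph>\<open>Simplicity.\<close> Let \<open>p\<close> be an element of an ideal that is not zero modulo the relators. As the
  products \<open>x x\<^sup>*\<close> sum to \<open>1\<close>, some right multiple of \<open>p\<close> by a word of letters of any given length is
  still nonzero. Long words of letters absorb all adjoints, so that this multiple is a combination
  of products \<open>u g\<close> of a word of letters and a group element, and still longer ones replace \<open>g\<close> by
  its sections. In a GGS-group, these end up in the set \<open>N = G \<union> H\<close> of generators, because \<open>N\<close> is
  closed under sections and the sections of a product of two elements of \<open>N\<close> at single letters are
  again in \<open>N\<close> (\<open>ggs_contracting\<close>). If now \<open>\<Phi> k\<close> is injective, then \<open>g \<in> G\<close> maps \<open>x\<^sub>k x\<^sub>0\<close> to
  \<open>x\<^sub>k x\<^sub>j\<close> with \<open>j = \<Phi> k g\<close>, and \<open>h \<in> H\<close> maps it to \<open>x\<^sub>i x\<^sub>0\<close> with \<open>i = h + k\<close>, both with trivial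
  section. Hence the images of \<open>x\<^sub>k x\<^sub>0\<close> tell the elements of \<open>N\<close> apart, and multiplication by
  \<open>x\<^sub>k x\<^sub>0\<close> turns a nontrivial combination of products \<open>u g\<close> into a nontrivial combination of words of
  letters. Multiplying by suitable words on both sides isolates one of its coefficients, so that
  the ideal contains \<open>1\<close>. The argument works for any self-similar group with such a set \<open>N\<close>
  (\<open>simple_nekrashevych_algebra_if_separated\<close>).

  \<^emph>\<open>Failure of simplicity.\<close> If no \<open>\<Phi> k\<close> is an isomorphism, then every \<open>e\<^sub>k\<close> has a prime factor in
  common with \<open>m\<close>. Let \<open>a\<close> be the product of the elements \<open>1 - t\<^bsup>m/p\<^esup>\<close> over the primes \<open>p\<close> dividing
  \<open>m\<close>. For \<open>k \<noteq> m - 1\<close>, one of the factors is killed by the linear extension of \<open>\<Phi> k\<close>, whence \<open>a x\<^sub>k = 0\<close>. So \<open>a\<close>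
  acts by zero except near \<open>(m-1)\<^sup>\<infinity>\<close>. Near \<open>(m-1)\<^sup>\<infinity>\<close>, however, distinct elements of \<open>G\<close> act
  differently, as \<open>m\<close> and the \<open>e\<^sub>k\<close> have no common factor. To exploit this, let \<open>\<psi>\<^sub>c\<close> be the linear
  functional on the free algebra whose value at a word of generators is \<open>1\<close> if the word acts as
  the identity near \<open>c\<^sup>\<infinity>\<close> and \<open>0\<close> otherwise. The largest ideal in its kernel contains the relators
  but not \<open>1\<close> (\<open>relator_ideal_subset_germ_ideal\<close>, \<open>one_notin_germ_ideal\<close>). It contains \<open>a\<close> if
  \<open>c = 0\<close>, but not if \<open>c = m - 1\<close>. The ideal belonging to \<open>c = 0\<close> therefore gives a proper nonzero
  ideal of the Nekrashevych algebra.

  If \<open>m\<close> is a power of a prime \<open>p\<close>, then \<open>p\<close> cannot divide all \<open>e\<^sub>k\<close>, so that some \<open>\<Phi> k\<close> is an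
  isomorphism.
\<close>

section \<open>Ideals of quotient rings and of free algebras\<close>

lemma (in ring) simple_ring_Quot_iff:
  assumes "ideal I R"
  shows "simple_ring (R Quot I) \<longleftrightarrow>
    I \<noteq> carrier R \<and> (\<forall>J. ideal J R \<longrightarrow> I \<subseteq> J \<longrightarrow> J = I \<or> J = carrier R)"
proof -
  interpret I: ideal I R by (rule assms)
  let ?\<pi> = "\<lambda>J. (+>) I ` J"
  have bij: "bij_betw ?\<pi> {J. ideal J R \<and> I \<subseteq> J} {J. ideal J (R Quot I)}"
    by (rule quot_ideal_correspondence[OF assms])
  have mem: "I \<in> {J. ideal J R \<and> I \<subseteq> J}" "carrier R \<in> {J. ideal J R \<and> I \<subseteq> J}"
    using assms oneideal I.a_subset by auto
  have "I +> i = I" if "i \<in> I" for i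
    by (rule I.a_rcos_const[OF that])
  moreover have "I \<noteq> {}"
    using I.zero_closed by blast
  ultimately have "?\<pi> I = {I}"
    by (auto simp: image_constant_conv)
  then have zero: "?\<pi> I = {\<zero>\<^bsub>R Quot I\<^esub>}"
    by (simp add: FactRing_def)
  have one: "?\<pi> (carrier R) = carrier (R Quot I)"
    by (auto simp: FactRing_simps)
  have inj: "?\<pi> J = ?\<pi> J' \<longleftrightarrow> J = J'"
    if "J \<in> {J. ideal J R \<and> I \<subseteq> J}" "J' \<in> {J. ideal J R \<and> I \<subseteq> J}" for J J'
    using bij that by (meson bij_betw_imp_inj_on inj_onD)
  have ideals: "{J. ideal J (R Quot I)} = ?\<pi> ` {J. ideal J R \<and> I \<subseteq> J}"
    using bij by (simp add: bij_betw_def)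
  have "(\<forall>J. ideal J (R Quot I) \<longrightarrow> J = ?\<pi> I \<or> J = ?\<pi> (carrier R)) \<longleftrightarrow>
      (\<forall>J \<in> {J. ideal J (R Quot I)}. J = ?\<pi> I \<or> J = ?\<pi> (carrier R))"
    by (simp only: mem_Collect_eq Ball_def)
  also have "\<dots> \<longleftrightarrow> (\<forall>J \<in> {J. ideal J R \<and> I \<subseteq> J}. ?\<pi> J = ?\<pi> I \<or> ?\<pi> J = ?\<pi> (carrier R))"
    by (simp only: ideals ball_simps)
  also have "\<dots> \<longleftrightarrow> (\<forall>J \<in> {J. ideal J R \<and> I \<subseteq> J}. J = I \<or> J = carrier R)"
    by (rule ball_cong[OF refl]) (simp only: inj[OF _ mem(1)] inj[OF _ mem(2)])
  also have "\<dots> \<longleftrightarrow> (\<forall>J. ideal J R \<longrightarrow> I \<subseteq> J \<longrightarrow> J = I \<or> J = carrier R)"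
    by (simp only: mem_Collect_eq Ball_def imp_conjL)
  finally have "(\<forall>J. ideal J (R Quot I) \<longrightarrow> J = {\<zero>\<^bsub>R Quot I\<^esub>} \<or> J = carrier (R Quot I)) \<longleftrightarrow>
      (\<forall>J. ideal J R \<longrightarrow> I \<subseteq> J \<longrightarrow> J = I \<or> J = carrier R)"
    unfolding zero one .
  moreover have "carrier (R Quot I) \<noteq> {\<zero>\<^bsub>R Quot I\<^esub>} \<longleftrightarrow> I \<noteq> carrier R"
    using inj[OF mem] unfolding zero one by metis
  ultimately show ?thesis
    using I.quotient_is_ring unfolding simple_ring_def by argo
qed

definition linear_ext :: "('w \<Rightarrow> 'k) \<Rightarrow> ('w \<Rightarrow>\<^sub>0 'k::comm_ring_1) \<Rightarrow> 'k" where
  "linear_ext \<phi> p = (\<Sum>w \<in> Poly_Mapping.keys p. Poly_Mapping.lookup p w * \<phi> w)"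

lemma linear_ext_superset:
  assumes "finite B" "Poly_Mapping.keys p \<subseteq> B"
  shows "linear_ext \<phi> p = (\<Sum>w \<in> B. Poly_Mapping.lookup p w * \<phi> w)"
  unfolding linear_ext_def
  by (rule sum.mono_neutral_left) (use assms in \<open>auto simp: in_keys_iff\<close>)

lemma linear_ext_zero [simp]: "linear_ext \<phi> 0 = 0"
  by (simp add: linear_ext_def)

lemma linear_ext_add [simp]: "linear_ext \<phi> (p + q) = linear_ext \<phi> p + linear_ext \<phi> q"
proof -
  let ?B = "Poly_Mapping.keys p \<union> Poly_Mapping.keys q"
  have "linear_ext \<phi> r = (\<Sum>w\<in>?B. Poly_Mapping.lookup r w * \<phi> w)"
    if "Poly_Mapping.keys r \<subseteq> ?B" for r
    by (rule linear_ext_superset) (use that in auto)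
  then show ?thesis
    by (simp add: keys_add lookup_add distrib_right sum.distrib)
qed

lemma linear_ext_single [simp]: "linear_ext \<phi> (Poly_Mapping.single w c) = c * \<phi> w"
  by (simp add: linear_ext_def)

lemma linear_ext_uminus [simp]: "linear_ext \<phi> (- p) = - linear_ext \<phi> p"
  using linear_ext_add[of \<phi> p "- p"] by (simp add: eq_neg_iff_add_eq_0 add.commute)

lemma linear_ext_diff [simp]: "linear_ext \<phi> (p - q) = linear_ext \<phi> p - linear_ext \<phi> q"
  using linear_ext_add[of \<phi> p "- q"] by simp

lemma linear_ext_sum: "linear_ext \<phi> (\<Sum>b\<in>B. f b) = (\<Sum>b\<in>B. linear_ext \<phi> (f b))"
  by (induction B rule: infinite_finite_induct) auto

lemma linear_ext_mult_left:
  fixes p q :: "('a, 'k::field) free_star"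
  shows "linear_ext \<phi> (p * q) = linear_ext (\<lambda>v. linear_ext (\<lambda>w. \<phi> (v + w)) q) p"
proof (induction p rule: free_star_induct)
  case (single v c p)
  have "linear_ext \<phi> (Poly_Mapping.single v c * q) = c * linear_ext (\<lambda>w. \<phi> (v + w)) q"
    by (induction q rule: free_star_induct) (simp_all add: mult_single algebra_simps)
  with single show ?case by (simp add: distrib_right)
qed simp

lemma linear_ext_mult_right:
  fixes p q :: "('a, 'k::field) free_star"
  shows "linear_ext \<phi> (p * q) = linear_ext (\<lambda>w. linear_ext (\<lambda>v. \<phi> (v + w)) p) q"
proof (induction q rule: free_star_induct)
  case (single w c q)
  have "linear_ext \<phi> (p * Poly_Mapping.single w c) = c * linear_ext (\<lambda>v. \<phi> (v + w)) p"
    by (induction p rule: free_star_induct) (simp_all add: mult_single algebra_simps)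
  with single show ?case by (simp add: distrib_left)
qed simp

lemma linear_ext_star:
  fixes p :: "('a, 'k::field) free_star"
  shows "linear_ext \<phi> (star p) = linear_ext (\<lambda>w. \<phi> (adj_word w)) p"
  by (induction p rule: free_star_induct) (simp_all add: star_add star_single)

lemma linear_ext_eq_zero:
  "(\<And>w. w \<in> Poly_Mapping.keys p \<Longrightarrow> \<phi> w = 0) \<Longrightarrow> linear_ext \<phi> p = 0"
  by (simp add: linear_ext_def)

text \<open>
  The elements all of whose multiples are killed by the linear functional \<open>\<psi>\<close> form the largest
  two-sided ideal on which \<open>\<psi>\<close> vanishes; multiples by words suffice.
\<close>

definition functional_ideal ::
    "'k::field itself \<Rightarrow> 'a set \<Rightarrow> ('a starred list \<Rightarrow> 'k) \<Rightarrow> ('a, 'k) free_star set" where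
  "functional_ideal K S \<psi> = {p \<in> carrier (free_star_algebra K S).
     \<forall>v \<in> lists (Plain ` S \<union> Adj ` S). \<forall>w \<in> lists (Plain ` S \<union> Adj ` S).
       linear_ext (\<lambda>u. \<psi> (v + u + w)) p = 0}"

lemma free_star_algebra_ideal_iff:
  fixes K :: "'k::field itself" and S :: "'a set"
  defines "F \<equiv> free_star_algebra K S"
  shows "ideal J F \<longleftrightarrow> J \<subseteq> carrier F \<and> 0 \<in> J \<and> (\<forall>p\<in>J. \<forall>q\<in>J. p - q \<in> J) \<and>
    (\<forall>p\<in>J. \<forall>q\<in>carrier F. q * p \<in> J \<and> p * q \<in> J)"
proof
  interpret F: ring F
    unfolding F_def by (rule ring_free_star_algebra)
  note closed = free_star_algebra_closed[where K = K and S = S, folded F_def]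
  note simps = free_star_algebra_simps[where K = K and S = S, folded F_def]
  have a_inv: "\<ominus>\<^bsub>F\<^esub> q = - q" if "q \<in> carrier F" for q
    using that by (intro F.minus_equality) (simp_all add: simps closed)
  {
    assume "ideal J F"
    then interpret J: ideal J F .
    have "p - q \<in> J" if "p \<in> J" "q \<in> J" for p q
      using J.a_closed[OF that(1) J.a_inv_closed[OF that(2)]] J.Icarr[OF that(2)]
      by (simp add: a_inv simps)
    then show "J \<subseteq> carrier F \<and> 0 \<in> J \<and> (\<forall>p\<in>J. \<forall>q\<in>J. p - q \<in> J) \<and>
        (\<forall>p\<in>J. \<forall>q\<in>carrier F. q * p \<in> J \<and> p * q \<in> J)"
      using J.Icarr J.zero_closed J.I_l_closed J.I_r_closed by (auto simp: simps)
  }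
  assume J: "J \<subseteq> carrier F \<and> 0 \<in> J \<and> (\<forall>p\<in>J. \<forall>q\<in>J. p - q \<in> J) \<and>
    (\<forall>p\<in>J. \<forall>q\<in>carrier F. q * p \<in> J \<and> p * q \<in> J)"
  then have uminus: "- p \<in> J" if "p \<in> J" for p
    using that by (metis diff_0)
  then have add: "p + q \<in> J" if "p \<in> J" "q \<in> J" for p q
    using that J by (metis diff_minus_eq_add)
  show "ideal J F"
  proof (rule idealI)
    show "subgroup J (add_monoid F)"
    proof (rule F.add.subgroupI)
      show "\<ominus>\<^bsub>F\<^esub> p \<in> J" if "p \<in> J" for p
        using that J uminus a_inv[of p] by auto
      show "p \<oplus>\<^bsub>F\<^esub> q \<in> J" if "p \<in> J" "q \<in> J" for p q
        using add[OF that] by (simp add: simps)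
    qed (use J in auto)
    show "x \<otimes>\<^bsub>F\<^esub> p \<in> J" "p \<otimes>\<^bsub>F\<^esub> x \<in> J" if "p \<in> J" "x \<in> carrier F" for p x
      using J that by (simp_all add: simps)
  qed (rule F.ring_axioms)
qed

lemma ideal_functional_ideal: "ideal (functional_ideal K S \<psi>) (free_star_algebra K S)"
proof -
  let ?L = "lists (Plain ` S \<union> Adj ` S)"
  let ?J = "functional_ideal K S \<psi>"
  have mult: "q * p \<in> ?J" "p * q \<in> ?J"
    if p: "p \<in> ?J" and q: "q \<in> carrier (free_star_algebra K S)" for p q
  proof -
    have q_keys: "u \<in> ?L" if "u \<in> Poly_Mapping.keys q" for u
      using q that by (auto simp: carrier_free_star_algebra lists_eq_set)
    have L_plus: "u + v \<in> ?L" if "u \<in> ?L" "v \<in> ?L" for u v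
      using that by (simp add: plus_list_def)
    have p_zero: "linear_ext (\<lambda>u. \<psi> (v + u + w)) p = 0" if "v \<in> ?L" "w \<in> ?L" for v w
      using p that by (simp add: functional_ideal_def)
    have "linear_ext (\<lambda>u. \<psi> (v + u + w)) (q * p) = 0" if "v \<in> ?L" "w \<in> ?L" for v w
      unfolding linear_ext_mult_left
      by (rule linear_ext_eq_zero, simp only: add.assoc[symmetric])
        (intro p_zero L_plus q_keys that)
    moreover have "linear_ext (\<lambda>u. \<psi> (v + u + w)) (p * q) = 0" if "v \<in> ?L" "w \<in> ?L" for v w
      unfolding linear_ext_mult_right
      by (rule linear_ext_eq_zero, simp only: add.assoc)
        (intro p_zero[unfolded add.assoc] L_plus q_keys that)
    moreover have "p \<in> carrier (free_star_algebra K S)"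
      using p by (simp add: functional_ideal_def)
    ultimately show "q * p \<in> ?J" "p * q \<in> ?J"
      using q by (simp_all add: functional_ideal_def free_star_algebra_closed)
  qed
  show ?thesis
    unfolding free_star_algebra_ideal_iff using mult
    by (auto simp: functional_ideal_def free_star_algebra_closed)
qed

section \<open>Words of generators as partial permutations\<close>

context self_similar_group
begin

lemma perm_Bij: "g \<in> \<Gamma> \<Longrightarrow> g \<in> Bij (lists A)"
  using subgroup.subset[OF subgroup_perms] by (auto simp: BijGroup_def)

lemma perm_closed: "g \<in> \<Gamma> \<Longrightarrow> w \<in> lists A \<Longrightarrow> g w \<in> lists A"
  by (rule funcset_mem[OF Bij_imp_funcset[OF perm_Bij]])

lemma perm_eqI:
  assumes "g \<in> \<Gamma>" "h \<in> \<Gamma>" "\<And>w. w \<in> lists A \<Longrightarrow> g w = h w"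
  shows "g = h"
  by (rule extensionalityI[of _ "lists A"]) (use assms perm_Bij in \<open>auto simp: Bij_def\<close>)

lemma one_in: "\<one>\<^bsub>BijGroup (lists A)\<^esub> \<in> \<Gamma>"
  by (rule subgroup.one_closed[OF subgroup_perms])

lemma mult_in: "g \<in> \<Gamma> \<Longrightarrow> h \<in> \<Gamma> \<Longrightarrow> g \<otimes>\<^bsub>BijGroup (lists A)\<^esub> h \<in> \<Gamma>"
  by (rule subgroup.m_closed[OF subgroup_perms])

lemma inv_in: "g \<in> \<Gamma> \<Longrightarrow> inv\<^bsub>BijGroup (lists A)\<^esub> g \<in> \<Gamma>"
  by (rule subgroup.m_inv_closed[OF subgroup_perms])

lemma one_apply: "w \<in> lists A \<Longrightarrow> \<one>\<^bsub>BijGroup (lists A)\<^esub> w = w"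
  by (simp add: BijGroup_def)

lemma mult_apply:
  "\<lbrakk>g \<in> \<Gamma>; h \<in> \<Gamma>; w \<in> lists A\<rbrakk> \<Longrightarrow> (g \<otimes>\<^bsub>BijGroup (lists A)\<^esub> h) w = g (h w)"
  using perm_Bij[of g] perm_Bij[of h] by (simp add: BijGroup_def compose_def)

lemma inv_apply:
  assumes "g \<in> \<Gamma>" "w \<in> lists A"
  shows "(inv\<^bsub>BijGroup (lists A)\<^esub> g) (g w) = w" "g ((inv\<^bsub>BijGroup (lists A)\<^esub> g) w) = w"
proof -
  interpret B: group "BijGroup (lists A)"
    by (rule group_BijGroup)
  have g: "g \<in> carrier (BijGroup (lists A))"
    using assms subgroup.subset[OF subgroup_perms] by blast
  show "(inv\<^bsub>BijGroup (lists A)\<^esub> g) (g w) = w"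
    using mult_apply[OF inv_in[OF assms(1)] assms] B.l_inv[OF g] one_apply[OF assms(2)] by simp
  show "g ((inv\<^bsub>BijGroup (lists A)\<^esub> g) w) = w"
    using mult_apply[OF assms(1) inv_in[OF assms(1)] assms(2)] B.r_inv[OF g] one_apply[OF assms(2)]
    by simp
qed

lemma perm_Nil [simp]: "g \<in> \<Gamma> \<Longrightarrow> g [] = []"
  using length_preserving[of g "[]"] by simp

lemma perm_singleton:
  assumes "g \<in> \<Gamma>" "x \<in> A"
  shows "g [x] = [hd (g [x])]" "hd (g [x]) \<in> A"
proof -
  have "length (g [x]) = 1" "g [x] \<in> lists A"
    using assms length_preserving[of g "[x]"] perm_closed[of g "[x]"] by auto
  then show "g [x] = [hd (g [x])]" "hd (g [x]) \<in> A"
    by (cases "g [x]"; simp)+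
qed

lemma group_section_eqI:
  assumes g: "g \<in> \<Gamma>" "x \<in> A" and h: "h \<in> \<Gamma>" "\<And>w. w \<in> lists A \<Longrightarrow> g (x # w) = g [x] @ h w"
  shows "group_section A \<Gamma> g x = h"
  unfolding group_section_def
proof (rule the_equality)
  fix h' assume h': "h' \<in> \<Gamma> \<and> (\<forall>w\<in>lists A. g (x # w) = g [x] @ h' w)"
  show "h' = h"
  proof (rule perm_eqI)
    fix w assume "w \<in> lists A"
    then have "g [x] @ h' w = g [x] @ h w"
      using h' h(2) by metis
    then show "h' w = h w" by simp
  qed (use h' h(1) in blast)+
qed (use h in blast)

lemma group_section_apply:
  assumes "g \<in> \<Gamma>" "x \<in> A" "w \<in> lists A"
  shows "g (x # w) = hd (g [x]) # group_section A \<Gamma> g x w"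
proof -
  obtain h where h: "h \<in> \<Gamma>" "\<And>w. w \<in> lists A \<Longrightarrow> g (x # w) = g [x] @ h w"
    using section_exists[OF assms(1,2)] by blast
  have "group_section A \<Gamma> g x = h"
    by (rule group_section_eqI[OF assms(1,2) h])
  then have "g (x # w) = g [x] @ group_section A \<Gamma> g x w"
    using h(2)[OF assms(3)] by simp
  then show ?thesis
    by (subst (asm) perm_singleton(1)[OF assms(1,2)]) simp
qed

fun word_section where
  "word_section g [] = g"
| "word_section g (x # w) = word_section (group_section A \<Gamma> g x) w"

lemma word_section_in: "g \<in> \<Gamma> \<Longrightarrow> w \<in> lists A \<Longrightarrow> word_section g w \<in> \<Gamma>"
  by (induction w arbitrary: g) (auto simp: group_section_in)

lemma word_section_append: "word_section g (v @ w) = word_section (word_section g v) w"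
  by (induction v arbitrary: g) auto

lemma word_section_apply:
  "\<lbrakk>g \<in> \<Gamma>; v \<in> lists A; w \<in> lists A\<rbrakk> \<Longrightarrow> g (v @ w) = g v @ word_section g v w"
proof (induction v arbitrary: g)
  case (Cons x v)
  then have "group_section A \<Gamma> g x (v @ w) =
      group_section A \<Gamma> g x v @ word_section (group_section A \<Gamma> g x) v w"
    by (intro Cons.IH) (auto simp: group_section_in)
  moreover have "g (x # v @ w) = hd (g [x]) # group_section A \<Gamma> g x (v @ w)"
    "g (x # v) = hd (g [x]) # group_section A \<Gamma> g x v"
    using Cons.prems by (intro group_section_apply; simp)+
  ultimately show ?case by simp
qed simp

lemma word_section_eqI:
  assumes "g \<in> \<Gamma>" "v \<in> lists A" "h \<in> \<Gamma>" "u \<in> lists A"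
    and "\<And>w. w \<in> lists A \<Longrightarrow> g (v @ w) = u @ h w"
  shows "word_section g v = h"
proof (rule perm_eqI)
  have "u = g v"
    using assms(5)[of "[]"] assms(3) by simp
  then show "word_section g v w = h w" if "w \<in> lists A" for w
    using assms(5)[OF that] word_section_apply[OF assms(1,2) that] by simp
  show "word_section g v \<in> \<Gamma>"
    by (rule word_section_in[OF assms(1,2)])
qed (rule assms(3))

lemma word_section_mult:
  assumes g: "g \<in> \<Gamma>" and h: "h \<in> \<Gamma>" and w: "w \<in> lists A"
  shows "word_section (g \<otimes>\<^bsub>BijGroup (lists A)\<^esub> h) w =
    word_section g (h w) \<otimes>\<^bsub>BijGroup (lists A)\<^esub> word_section h w"
proof -
  note hw = perm_closed[OF h w]
  note s_g = word_section_in[OF g hw] and s_h = word_section_in[OF h w]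
  show ?thesis
  proof (rule word_section_eqI[OF mult_in[OF g h] w mult_in[OF s_g s_h] perm_closed[OF g hw]])
    fix v assume v: "v \<in> lists A"
    then have wv: "w @ v \<in> lists A"
      using w by simp
    have "(g \<otimes>\<^bsub>BijGroup (lists A)\<^esub> h) (w @ v) = g (h w @ word_section h w v)"
      by (simp only: mult_apply[OF g h wv] word_section_apply[OF h w v])
    also have "\<dots> = g (h w) @ word_section g (h w) (word_section h w v)"
      by (rule word_section_apply[OF g hw perm_closed[OF s_h v]])
    finally show "(g \<otimes>\<^bsub>BijGroup (lists A)\<^esub> h) (w @ v) =
        g (h w) @ (word_section g (h w) \<otimes>\<^bsub>BijGroup (lists A)\<^esub> word_section h w) v"
      by (simp only: mult_apply[OF s_g s_h v])
  qed
qed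

text \<open>
  On finite words, a letter \<open>x\<close> acts by prepending \<open>x\<close>, its adjoint by removing an initial \<open>x\<close>, which
  is only partially defined. The defining relations without sums hold for these partial maps.
  In the sum of the products \<open>x x\<^sup>*\<close>, the summand that acts on a word depends on its first letter,
  which is why germs enter below.
\<close>

fun letter_act :: "'x nek_gen starred \<Rightarrow> 'x list \<Rightarrow> 'x list option" where
  "letter_act (Plain (Letter x)) w = Some (x # w)"
| "letter_act (Adj (Letter x)) w = (if w \<noteq> [] \<and> hd w = x then Some (tl w) else None)"
| "letter_act (Plain (Elem g)) w = Some (g w)"
| "letter_act (Adj (Elem g)) w = Some ((inv\<^bsub>BijGroup (lists A)\<^esub> g) w)"

fun word_act :: "'x nek_gen starred list \<Rightarrow> 'x list \<Rightarrow> 'x list option" where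
  "word_act [] w = Some w"
| "word_act (a # s) w = Option.bind (word_act s w) (letter_act a)"

definition alphabet :: "'x nek_gen starred set" where
  "alphabet = Plain ` (Letter ` A \<union> Elem ` \<Gamma>) \<union> Adj ` (Letter ` A \<union> Elem ` \<Gamma>)"

lemma alphabet_cases [consumes 1, case_names letter adj_letter elem adj_elem]:
  assumes "a \<in> alphabet"
  obtains x where "x \<in> A" "a = Plain (Letter x)"
    | x where "x \<in> A" "a = Adj (Letter x)"
    | g where "g \<in> \<Gamma>" "a = Plain (Elem g)"
    | g where "g \<in> \<Gamma>" "a = Adj (Elem g)"
  using assms unfolding alphabet_def by blast

lemma alphabet_simps [simp]:
  "Plain (Letter x) \<in> alphabet \<longleftrightarrow> x \<in> A" "Adj (Letter x) \<in> alphabet \<longleftrightarrow> x \<in> A"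
  "Plain (Elem g) \<in> alphabet \<longleftrightarrow> g \<in> \<Gamma>" "Adj (Elem g) \<in> alphabet \<longleftrightarrow> g \<in> \<Gamma>"
  by (auto simp: alphabet_def)

lemma adj_alphabet: "a \<in> alphabet \<Longrightarrow> adj a \<in> alphabet"
  by (cases a rule: adj.cases) (auto simp: alphabet_def)

lemma letter_act_closed:
  assumes "a \<in> alphabet" "w \<in> lists A" "letter_act a w = Some v"
  shows "v \<in> lists A"
  using assms(1)
proof (cases a rule: alphabet_cases)
  case (adj_letter x)
  with assms show ?thesis
    by (cases w) (auto split: if_splits)
next
  case (elem g)
  with assms show ?thesis
    using perm_closed[of g w] by simp
next
  case (adj_elem g)
  with assms show ?thesis
    using perm_closed[OF inv_in, of g w] by simp
qed (use assms in auto)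

lemma word_act_closed:
  "\<lbrakk>s \<in> lists alphabet; w \<in> lists A; word_act s w = Some v\<rbrakk> \<Longrightarrow> v \<in> lists A"
proof (induction s arbitrary: v)
  case (Cons a s)
  then obtain u where u: "word_act s w = Some u" "letter_act a u = Some v"
    by (auto simp: bind_eq_Some_conv)
  have "u \<in> lists A"
    by (rule Cons.IH[OF _ _ u(1)]) (use Cons.prems in auto)
  moreover have "a \<in> alphabet"
    using Cons.prems(1) by simp
  ultimately show ?case
    using letter_act_closed u(2) by blast
qed simp

lemma word_act_append: "word_act (s @ t) w = Option.bind (word_act t w) (word_act s)"
  by (induction s) (auto simp: Option.bind_assoc fun_eq_iff)

lemma letter_act_adj:
  assumes "a \<in> alphabet" "v \<in> lists A" "w \<in> lists A"
  shows "letter_act a w = Some v \<longleftrightarrow> letter_act (adj a) v = Some w"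
  using assms(1)
proof (cases a rule: alphabet_cases)
  case (letter x)
  then show ?thesis by (cases v) auto
next
  case (adj_letter x)
  then show ?thesis by (cases w) auto
qed (use assms inv_apply in auto)

text \<open>Adjoints act by the inverse partial bijections.\<close>

lemma word_act_adj:
  "\<lbrakk>s \<in> lists alphabet; v \<in> lists A; w \<in> lists A\<rbrakk>
    \<Longrightarrow> word_act s w = Some v \<longleftrightarrow> word_act (adj_word s) v = Some w"
proof (induction s arbitrary: v)
  case (Cons a s)
  have "word_act (a # s) w = Some v \<longleftrightarrow> (\<exists>u \<in> lists A. word_act s w = Some u \<and> letter_act a u = Some v)"
    using Cons.prems word_act_closed[of s w] by (auto simp: bind_eq_Some_conv)
  also have "\<dots> \<longleftrightarrow> (\<exists>u \<in> lists A. word_act (adj_word s) u = Some w \<and> letter_act (adj a) v = Some u)"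
    using Cons letter_act_adj[of a] by (intro bex_cong) auto
  also have "\<dots> \<longleftrightarrow> word_act (adj_word (a # s)) v = Some w"
    using Cons.prems letter_act_closed[of "adj a" v] adj_alphabet[of a]
    by (auto simp: adj_word_def word_act_append bind_eq_Some_conv)
  finally show ?case .
qed (auto simp: adj_word_def)

end

section \<open>The ideal of a germ\<close>

lemma linear_ext_one [simp]: "linear_ext \<phi> 1 = \<phi> 0"
  by (simp flip: single_one)

context self_similar_group
begin

text \<open>
  Near \<open>c\<^sup>\<infinity>\<close>, a word of generators is either undefined or of the form \<open>c\<^sup>n u \<mapsto> v g(u)\<close>. The only
  generators that can destroy this form are adjoints of letters in the case that \<open>v\<close> is empty; then
  increasing \<open>n\<close> makes the first letter of \<open>g(u)\<close> constant.
\<close>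

lemma word_germ:
  assumes "s \<in> lists alphabet" "c \<in> A"
  shows "\<exists>n. (\<forall>u\<in>lists A. word_act s (replicate n c @ u) = None) \<or>
    (\<exists>v\<in>lists A. \<exists>g\<in>\<Gamma>. \<forall>u\<in>lists A. word_act s (replicate n c @ u) = Some (v @ g u))"
  using assms(1)
proof (induction s)
  case Nil
  have "word_act [] (replicate 0 c @ u) = Some ([] @ \<one>\<^bsub>BijGroup (lists A)\<^esub> u)" if "u \<in> lists A" for u
    using one_apply[OF that] by simp
  then show ?case
    using one_in by blast
next
  case (Cons a s)
  then have a: "a \<in> alphabet" by simp
  from Cons obtain n where
    "(\<forall>u\<in>lists A. word_act s (replicate n c @ u) = None) \<or>
      (\<exists>v\<in>lists A. \<exists>g\<in>\<Gamma>. \<forall>u\<in>lists A. word_act s (replicate n c @ u) = Some (v @ g u))"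
    by auto
  then consider "\<And>u. u \<in> lists A \<Longrightarrow> word_act s (replicate n c @ u) = None"
    | v g where "v \<in> lists A" "g \<in> \<Gamma>" "\<And>u. u \<in> lists A \<Longrightarrow> word_act s (replicate n c @ u) = Some (v @ g u)"
    by blast
  then show ?case
  proof cases
    case 1
    then show ?thesis by (intro exI[of _ n]) auto
  next
    case (2 v g)
    have perm: "\<exists>v\<in>lists A. \<exists>k\<in>\<Gamma>. \<forall>u\<in>lists A. word_act (a # s) (replicate n c @ u) = Some (v @ k u)"
      if h: "h \<in> \<Gamma>" "letter_act a = (\<lambda>w. Some (h w))" for h
    proof (rule bexI, rule bexI)
      show "\<forall>u\<in>lists A. word_act (a # s) (replicate n c @ u) =
          Some (h v @ (word_section h v \<otimes>\<^bsub>BijGroup (lists A)\<^esub> g) u)"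
        using 2(3) word_section_apply[OF h(1) 2(1) perm_closed[OF 2(2)]]
          mult_apply[OF word_section_in[OF h(1) 2(1)] 2(2)]
        by (simp add: h(2) del: in_lists_conv_set)
    qed (intro mult_in word_section_in perm_closed[OF h(1) 2(1)] h 2)+
    from a show ?thesis
    proof (cases a rule: alphabet_cases)
      case (letter x)
      then have "\<forall>u\<in>lists A. word_act (a # s) (replicate n c @ u) = Some ((x # v) @ g u)"
        using 2(3) by simp
      moreover have "x # v \<in> lists A"
        using letter(1) 2(1) by simp
      ultimately show ?thesis
        using 2(2) by blast
    next
      case (adj_letter x)
      show ?thesis
      proof (cases v)
        case (Cons y v')
        then have "word_act (a # s) (replicate n c @ u) = (if y = x then Some (v' @ g u) else None)"
          if "u \<in> lists A" for u
          using 2(3)[OF that] adj_letter(2) by simp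
        moreover have "v' \<in> lists A"
          using 2(1) Cons by simp
        ultimately show ?thesis
          using 2(2) by (cases "y = x") (metis, metis)
      next
        case Nil
        have "word_act (a # s) (replicate (Suc n) c @ u) =
            (if hd (g [c]) = x then Some ([] @ group_section A \<Gamma> g c u) else None)"
          if u: "u \<in> lists A" for u
        proof -
          have "word_act s (replicate (Suc n) c @ u) = Some (g (c # u))"
            using 2(3)[of "c # u"] u assms(2) Nil by (simp add: replicate_app_Cons_same)
          then show ?thesis
            using adj_letter(2) group_section_apply[OF 2(2) assms(2) u] by simp
        qed
        then show ?thesis
          using group_section_in[OF 2(2) assms(2)] lists.Nil[of A]
          by (cases "hd (g [c]) = x") (metis, metis)
      qed
    next
      case (elem h)
      then show ?thesis
        using perm[of h] by (simp add: fun_eq_iff) blast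
    next
      case (adj_elem h)
      then show ?thesis
        using perm[of "inv\<^bsub>BijGroup (lists A)\<^esub> h"] inv_in by (simp add: fun_eq_iff) blast
    qed
  qed
qed

lemma word_germ_extend:
  assumes "c \<in> A" "v \<in> lists A" "g \<in> \<Gamma>"
    and "\<And>u. u \<in> lists A \<Longrightarrow> word_act s (replicate n c @ u) = Some (v @ g u)"
    and "u \<in> lists A"
  shows "word_act s (replicate (n + k) c @ u) =
    Some (v @ g (replicate k c) @ word_section g (replicate k c) u)"
proof -
  have c: "replicate k c \<in> lists A"
    using assms(1) by auto
  have "word_act s (replicate (n + k) c @ u) = Some (v @ g (replicate k c @ u))"
    using assms(4)[of "replicate k c @ u"] c assms(5) by (simp add: replicate_add)
  then show ?thesis
    by (simp only: word_section_apply[OF assms(3) c assms(5)])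
qed

text \<open>
  The matrix coefficient, at the germ of the identity at \<open>c\<^sup>\<infinity>\<close>, of the representation of the algebra
  on germs at \<open>c\<^sup>\<infinity>\<close>. The ideal belonging to it is the kernel of the subrepresentation generated by
  this germ, so that the representation itself need not be constructed.
\<close>

definition germ_functional :: "'x \<Rightarrow> 'x nek_gen starred list \<Rightarrow> 'k::field" where
  "germ_functional c s = (if \<exists>n. \<forall>u\<in>lists A.
     word_act s (replicate n c @ u) = Some (replicate n c @ u) then 1 else 0)"

lemma germ_functional_cong:
  assumes c: "c \<in> A"
    and eq: "\<And>u. u \<in> lists A \<Longrightarrow> word_act s (replicate n c @ u) = word_act t (replicate n c @ u)"
  shows "germ_functional c s = germ_functional c t"
proof -
  have "\<exists>k. \<forall>u\<in>lists A. word_act t (replicate k c @ u) = Some (replicate k c @ u)"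
    if fix_s: "\<And>u. u \<in> lists A \<Longrightarrow> word_act s (replicate k c @ u) = Some (replicate k c @ u)"
      and eq: "\<And>u. u \<in> lists A \<Longrightarrow> word_act s (replicate n c @ u) = word_act t (replicate n c @ u)"
    for s t k
  proof (intro exI ballI)
    fix u assume u: "u \<in> lists A"
    have "replicate k c @ u \<in> lists A" "replicate n c @ u \<in> lists A"
      using u c by auto
    then show "word_act t (replicate (n + k) c @ u) = Some (replicate (n + k) c @ u)"
      using eq[of "replicate k c @ u"] fix_s[of "replicate n c @ u"]
      by (metis append_assoc replicate_add add.commute)
  qed
  from this[of s _ t] this[of t _ s] eq show ?thesis
    unfolding germ_functional_def by metis
qed

lemma germ_functional_eq_zero:
  assumes "c \<in> A" "\<And>u. u \<in> lists A \<Longrightarrow> word_act s (replicate n c @ u) = None"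
  shows "germ_functional c s = 0"
proof -
  have "\<not> (\<forall>u\<in>lists A. word_act s (replicate k c @ u) = Some (replicate k c @ u))" for k
  proof
    assume *: "\<forall>u\<in>lists A. word_act s (replicate k c @ u) = Some (replicate k c @ u)"
    have "replicate n c \<in> lists A" "replicate k c \<in> lists A"
      using assms(1) by auto
    then show False
      using * assms(2)[of "replicate k c"]
      by (metis replicate_add add.commute option.distinct(1))
  qed
  then show ?thesis
    by (simp add: germ_functional_def)
qed

lemma germ_functional_Nil [simp]: "germ_functional c [] = 1"
  by (simp add: germ_functional_def)

text \<open>
  This reduces a relation between words to the equality of their actions on finite words.
\<close>

lemma germ_functional_subst:
  assumes "c \<in> A" "w \<in> lists alphabet" "\<And>u. u \<in> lists A \<Longrightarrow> word_act s u = word_act t u"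
  shows "germ_functional c (v @ s @ w) = germ_functional c (v @ t @ w)"
proof (rule germ_functional_cong[OF assms(1), where n = 0])
  fix u assume u: "u \<in> lists A"
  show "word_act (v @ s @ w) (replicate 0 c @ u) = word_act (v @ t @ w) (replicate 0 c @ u)"
    using word_act_closed[OF assms(2) u] assms(3)
    by (cases "word_act w u") (auto simp: word_act_append simp del: in_lists_conv_set)
qed

lemma germ_functional_adj:
  assumes "c \<in> A" "s \<in> lists alphabet"
  shows "germ_functional c (adj_word s) = germ_functional c s"
proof -
  have "word_act (adj_word s) (replicate n c @ u) = Some (replicate n c @ u) \<longleftrightarrow>
      word_act s (replicate n c @ u) = Some (replicate n c @ u)" if "u \<in> lists A" for n u
    by (rule word_act_adj[symmetric, OF assms(2)]) (use that assms(1) in auto)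
  then show ?thesis
    unfolding germ_functional_def by (metis (no_types, lifting))
qed

abbreviation germ_ideal :: "'k::field itself \<Rightarrow> 'x \<Rightarrow> ('x nek_gen, 'k) free_star set" where
  "germ_ideal K c \<equiv> functional_ideal K (Letter ` A \<union> Elem ` \<Gamma>) (germ_functional c)"

lemma mem_germ_ideal_iff:
  "p \<in> germ_ideal K c \<longleftrightarrow> p \<in> carrier (free_star_algebra K (Letter ` A \<union> Elem ` \<Gamma>)) \<and>
    (\<forall>v \<in> lists alphabet. \<forall>w \<in> lists alphabet.
      linear_ext (\<lambda>u. germ_functional c (v @ u @ w)) p = 0)"
  by (simp add: functional_ideal_def alphabet_def plus_list_def)

text \<open>
  A partial bijection and its inverse fix the same words, so the functional is invariant under
  adjunction. Therefore only the relators, and not their adjoints, have to be considered.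
\<close>

lemma star_germ_ideal:
  assumes c: "c \<in> A" and p: "p \<in> germ_ideal K c"
  shows "star p \<in> germ_ideal K c"
proof -
  have adj_in: "adj_word s \<in> lists alphabet" if "s \<in> lists alphabet" for s
    using that adj_alphabet by (auto simp: adj_word_def)
  have p_carrier: "p \<in> carrier (free_star_algebra K (Letter ` A \<union> Elem ` \<Gamma>))"
    using p by (simp add: functional_ideal_def)
  have "linear_ext (\<lambda>u. germ_functional c (v @ u @ w)) (star p) = 0"
    if vw: "v \<in> lists alphabet" "w \<in> lists alphabet" for v w
  proof -
    have "linear_ext (\<lambda>u. germ_functional c (v @ u @ w)) (star p) =
        linear_ext (\<lambda>u. germ_functional c (adj_word w @ u @ adj_word v)) p"
      unfolding linear_ext_star unfolding linear_ext_def
    proof (rule sum.cong[OF refl])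
      fix u assume "u \<in> Poly_Mapping.keys p"
      then have "u \<in> lists alphabet"
        using p_carrier by (auto simp: carrier_free_star_algebra alphabet_def lists_eq_set)
      then have in_alphabet: "adj_word w @ u @ adj_word v \<in> lists alphabet"
        using vw adj_in by auto
      have adj_eq: "adj_word (adj_word w @ u @ adj_word v) = v @ adj_word u @ w"
        by (metis adj_word_plus adj_word_adj_word plus_list_def append_assoc)
      show "Poly_Mapping.lookup p u * germ_functional c (v @ adj_word u @ w) =
          Poly_Mapping.lookup p u * germ_functional c (adj_word w @ u @ adj_word v)"
        by (simp only: adj_eq[symmetric] germ_functional_adj[OF c in_alphabet])
    qed
    also have "\<dots> = 0"
      using p vw adj_in unfolding mem_germ_ideal_iff by blast
    finally show ?thesis .
  qed
  then show ?thesis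
    unfolding mem_germ_ideal_iff using free_star_algebra_closed(7)[OF p_carrier] by blast
qed

lemma linear_ext_relator:
  assumes c: "c \<in> A" and v: "v \<in> lists alphabet" and w: "w \<in> lists alphabet"
    and p: "p \<in> nek_relators A \<Gamma>"
  shows "linear_ext (\<lambda>u. germ_functional c (v @ u @ w)) p = (0 :: 'k::field)"
proof -
  let ?B = "BijGroup (lists A)"
  let ?\<phi> = "\<lambda>u. germ_functional c (v @ u @ w) :: 'k"
  have subst: "?\<phi> s = ?\<phi> t" if "\<And>u. u \<in> lists A \<Longrightarrow> word_act s u = word_act t u" for s t
    by (rule germ_functional_subst[OF c w that])
  note simps = gen_def star_single mult_single adj_word_def plus_list_def zero_list_def
  from p consider "p = gen (Elem \<one>\<^bsub>?B\<^esub>) - 1"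
    | g where "g \<in> \<Gamma>" "p = star (gen (Elem g)) - gen (Elem (inv\<^bsub>?B\<^esub> g))"
    | g h where "g \<in> \<Gamma>" "h \<in> \<Gamma>" "p = gen (Elem g) * gen (Elem h) - gen (Elem (g \<otimes>\<^bsub>?B\<^esub> h))"
    | g x where "g \<in> \<Gamma>" "x \<in> A"
        "p = gen (Elem g) * gen (Letter x) - gen (Letter (hd (g [x]))) * gen (Elem (group_section A \<Gamma> g x))"
    | x y where "x \<in> A" "y \<in> A" "p = star (gen (Letter y)) * gen (Letter x) - (if x = y then 1 else 0)"
    | "p = (\<Sum>x\<in>A. gen (Letter x) * star (gen (Letter x))) - 1"
    unfolding nek_relators_def by blast
  then show ?thesis
  proof cases
    case 1
    have "?\<phi> [Plain (Elem \<one>\<^bsub>?B\<^esub>)] = ?\<phi> []"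
      by (rule subst) (simp add: one_apply del: in_lists_conv_set)
    with 1 show ?thesis by (simp add: simps)
  next
    case (2 g)
    have "?\<phi> [Adj (Elem g)] = ?\<phi> [Plain (Elem (inv\<^bsub>?B\<^esub> g))]"
      by (rule subst) simp
    with 2 show ?thesis by (simp add: simps)
  next
    case (3 g h)
    have "?\<phi> [Plain (Elem g), Plain (Elem h)] = ?\<phi> [Plain (Elem (g \<otimes>\<^bsub>?B\<^esub> h))]"
      by (rule subst) (simp add: mult_apply[OF 3(1,2)] del: in_lists_conv_set)
    with 3 show ?thesis by (simp add: simps)
  next
    case (4 g x)
    have "?\<phi> [Plain (Elem g), Plain (Letter x)] =
        ?\<phi> [Plain (Letter (hd (g [x]))), Plain (Elem (group_section A \<Gamma> g x))]"
      by (rule subst) (simp del: in_lists_conv_set, rule group_section_apply[OF 4(1,2)])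
    with 4 show ?thesis by (simp add: simps)
  next
    case (5 x y)
    show ?thesis
    proof (cases "x = y")
      case True
      have "?\<phi> [Adj (Letter y), Plain (Letter x)] = ?\<phi> []"
        by (rule subst) (simp add: True)
      with 5 True show ?thesis by (simp add: simps)
    next
      case False
      have "?\<phi> [Adj (Letter y), Plain (Letter x)] = 0"
        by (rule germ_functional_eq_zero[OF c, where n = 0])
          (use False in \<open>auto simp: word_act_append bind_eq_None_conv\<close>)
      with 5 False show ?thesis by (simp add: simps)
    qed
  next
    case 6
    have "(\<Sum>x\<in>A. ?\<phi> [Plain (Letter x), Adj (Letter x)]) = ?\<phi> []"
    proof -
      obtain n where "(\<forall>u\<in>lists A. word_act w (replicate n c @ u) = None) \<or>
          (\<exists>v\<in>lists A. \<exists>g\<in>\<Gamma>. \<forall>u\<in>lists A. word_act w (replicate n c @ u) = Some (v @ g u))"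
        using word_germ[OF w c] by blast
      then consider "\<And>u. u \<in> lists A \<Longrightarrow> word_act w (replicate n c @ u) = None"
        | v' g where "v' \<in> lists A" "g \<in> \<Gamma>"
          "\<And>u. u \<in> lists A \<Longrightarrow> word_act w (replicate n c @ u) = Some (v' @ g u)"
        by blast
      then show ?thesis
      proof cases
        case 1
        have zero: "?\<phi> s = 0" for s
          by (rule germ_functional_eq_zero[OF c, where n = n]) (simp add: word_act_append 1 del: in_lists_conv_set)
        show ?thesis by (simp only: zero sum.neutral_const)
      next
        case (2 v' g)
        (* After one more letter, all words in the image of the germ start with the same letter y,
           so that exactly the summand x = y of the relator contributes. *)
        obtain z where "z \<in> A" "g [c] = [z]"
          using perm_singleton[OF 2(2) c] by blast
        then have "v' @ g [c] \<in> lists A" "v' @ g [c] \<noteq> []"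
          using 2(1) by auto
        then obtain y v'' where y: "y \<in> A" "v' @ g [c] = y # v''"
          by (cases "v' @ g [c]") auto
        have act: "word_act w (replicate (n + 1) c @ u) = Some (y # v'' @ word_section g [c] u)"
          if "u \<in> lists A" for u
          using word_germ_extend[OF c 2 that, of 1] y(2) by (simp del: in_lists_conv_set flip: append_assoc)
        have "?\<phi> [Plain (Letter x), Adj (Letter x)] = (if x = y then ?\<phi> [] else 0)" for x
        proof (cases "x = y")
          case True
          have "?\<phi> [Plain (Letter x), Adj (Letter x)] = ?\<phi> []"
            by (rule germ_functional_cong[OF c, where n = "n + 1"])
              (simp only: word_act_append act, simp add: True)
          with True show ?thesis by simp
        next
          case False
          have "?\<phi> [Plain (Letter x), Adj (Letter x)] = 0"
            by (rule germ_functional_eq_zero[OF c, where n = "n + 1"])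
              (simp only: word_act_append act, use False in simp)
          with False show ?thesis by simp
        qed
        then show ?thesis
          using y(1) finite_alphabet by simp
      qed
    qed
    with 6 show ?thesis
      by (simp add: simps linear_ext_sum)
  qed
qed

abbreviation relator_ideal :: "'k::field itself \<Rightarrow> ('x nek_gen, 'k) free_star set" where
  "relator_ideal K \<equiv> Idl\<^bsub>free_star_algebra K (Letter ` A \<union> Elem ` \<Gamma>)\<^esub>
     (nek_relators A \<Gamma> \<union> star ` nek_relators A \<Gamma>)"

lemma relator_ideal_subset_germ_ideal:
  assumes "c \<in> A"
  shows "relator_ideal K \<subseteq> germ_ideal K c"
proof -
  interpret F: ring "free_star_algebra K (Letter ` A \<union> Elem ` \<Gamma>)"
    by (rule ring_free_star_algebra)
  have "nek_relators A \<Gamma> \<subseteq> germ_ideal K c"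
    unfolding mem_germ_ideal_iff subset_eq
    using linear_ext_relator[OF assms] nek_relators_carrier[of K] by blast
  then show ?thesis
    using star_germ_ideal[OF assms] by (intro F.genideal_minimal ideal_functional_ideal) blast
qed

lemma one_notin_germ_ideal: "1 \<notin> germ_ideal K c"
proof
  assume "1 \<in> germ_ideal K c"
  then have "linear_ext (\<lambda>u. germ_functional c ([] @ u @ [])) (1 :: ('x nek_gen, 'a) free_star) = 0"
    unfolding mem_germ_ideal_iff by (blast intro: lists.Nil)
  then show False
    by (simp add: zero_list_def)
qed

lemma ideal_relator_ideal: "ideal (relator_ideal K) (free_star_algebra K (Letter ` A \<union> Elem ` \<Gamma>))"
  using nek_relators_carrier[of K] free_star_algebra_closed(7)
  by (intro ring.genideal_ideal[OF ring_free_star_algebra]) blast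

text \<open>
  The germ ideals show that the algebra is nonzero, so that only the condition on ideals remains.
\<close>

lemma simple_nekrashevych_algebra_iff:
  "simple_ring (nekrashevych_algebra K A \<Gamma>) \<longleftrightarrow>
    (\<forall>J. ideal J (free_star_algebra K (Letter ` A \<union> Elem ` \<Gamma>)) \<longrightarrow> relator_ideal K \<subset> J \<longrightarrow> 1 \<in> J)"
proof -
  let ?F = "free_star_algebra K (Letter ` A \<union> Elem ` \<Gamma>)"
  interpret F: ring ?F
    by (rule ring_free_star_algebra)
  obtain c where "c \<in> A"
    using card_alphabet by fastforce
  then have "relator_ideal K \<noteq> carrier ?F"
    using relator_ideal_subset_germ_ideal[of c K] one_notin_germ_ideal[of K c]
      free_star_algebra_closed(1)[of K] by blast
  moreover have "J = carrier ?F \<longleftrightarrow> 1 \<in> J" if "ideal J ?F" for J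
    using ideal.one_imp_carrier[OF that] free_star_algebra_closed(1)[of K] by auto
  ultimately show ?thesis
    unfolding nekrashevych_algebra_def presented_star_algebra_def
      F.simple_ring_Quot_iff[OF ideal_relator_ideal] by blast
qed

end

section \<open>Normal forms modulo the relators\<close>

lemma sum_monomials:
  fixes p :: "'a \<Rightarrow>\<^sub>0 'k::comm_monoid_add"
  shows "(\<Sum>s\<in>Poly_Mapping.keys p. Poly_Mapping.single s (Poly_Mapping.lookup p s)) = p"
proof (rule poly_mapping_eqI)
  fix t
  have "Poly_Mapping.lookup (\<Sum>s\<in>Poly_Mapping.keys p. Poly_Mapping.single s (Poly_Mapping.lookup p s)) t =
      (\<Sum>s\<in>Poly_Mapping.keys p. if s = t then Poly_Mapping.lookup p s else 0)"
    by (simp add: lookup_sum lookup_single when_def)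
  then show "Poly_Mapping.lookup (\<Sum>s\<in>Poly_Mapping.keys p. Poly_Mapping.single s (Poly_Mapping.lookup p s)) t =
      Poly_Mapping.lookup p t"
    by (simp add: in_keys_iff)
qed

abbreviation letters :: "'x list \<Rightarrow> 'x nek_gen starred list" where
  "letters w \<equiv> map (\<lambda>x. Plain (Letter x)) w"

abbreviation co_letters :: "'x list \<Rightarrow> 'x nek_gen starred list" where
  "co_letters w \<equiv> map (\<lambda>x. Adj (Letter x)) (rev w)"

abbreviation mon :: "'a starred list \<Rightarrow> ('a, 'k::field) free_star" where
  "mon s \<equiv> Poly_Mapping.single s 1"

lemma mon_append: "mon (s @ t) = mon s * mon t"
  by (simp add: mult_single plus_list_def)

lemma mon_Nil: "mon [] = 1"
  by (simp flip: single_one add: zero_list_def)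

lemma single_eq_scalar_mult:
  "Poly_Mapping.single s (c :: 'k::field) = Poly_Mapping.single [] c * mon s"
  by (simp add: mult_single plus_list_def)

context self_similar_group
begin

abbreviation F :: "('x nek_gen, 'k::field) free_star ring" where
  "F \<equiv> free_star_algebra TYPE('k) (Letter ` A \<union> Elem ` \<Gamma>)"

abbreviation I :: "('x nek_gen, 'k::field) free_star set" where
  "I \<equiv> relator_ideal TYPE('k)"

lemma carrier_F_iff: "p \<in> carrier F \<longleftrightarrow> Poly_Mapping.keys p \<subseteq> lists alphabet"
  by (auto simp: carrier_free_star_algebra alphabet_def lists_eq_set)

lemma single_in_F: "s \<in> lists alphabet \<Longrightarrow> Poly_Mapping.single s c \<in> carrier F"
  by (auto simp: carrier_F_iff)

lemma sum_in_F: "(\<And>b. b \<in> B \<Longrightarrow> f b \<in> carrier F) \<Longrightarrow> sum f B \<in> carrier F"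
  by (induction B rule: infinite_finite_induct) (auto simp: free_star_algebra_closed)

lemma ideal_I: "ideal I F"
  by (rule ideal_relator_ideal)

lemma ideal_F_closed:
  assumes "ideal J F"
  shows "0 \<in> J" "J \<subseteq> carrier F" "\<lbrakk>p \<in> J; q \<in> J\<rbrakk> \<Longrightarrow> p - q \<in> J" "\<lbrakk>p \<in> J; q \<in> J\<rbrakk> \<Longrightarrow> p + q \<in> J"
    "\<lbrakk>p \<in> J; q \<in> carrier F\<rbrakk> \<Longrightarrow> p * q \<in> J" "\<lbrakk>p \<in> J; q \<in> carrier F\<rbrakk> \<Longrightarrow> q * p \<in> J"
proof -
  note J = assms[unfolded free_star_algebra_ideal_iff]
  show diff: "p - q \<in> J" if "p \<in> J" "q \<in> J" for p q
    using J that by blast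
  show "0 \<in> J" "J \<subseteq> carrier F" "\<lbrakk>p \<in> J; q \<in> carrier F\<rbrakk> \<Longrightarrow> p * q \<in> J"
    "\<lbrakk>p \<in> J; q \<in> carrier F\<rbrakk> \<Longrightarrow> q * p \<in> J"
    using J by blast+
  then show "\<lbrakk>p \<in> J; q \<in> J\<rbrakk> \<Longrightarrow> p + q \<in> J"
    using diff[of p "0 - q"] diff[of 0 q] by simp
qed

lemmas I_closed = ideal_F_closed[OF ideal_I]

lemma ideal_F_sum: "ideal J F \<Longrightarrow> (\<And>b. b \<in> B \<Longrightarrow> f b \<in> J) \<Longrightarrow> sum f B \<in> J"
  by (induction B rule: infinite_finite_induct) (auto simp: ideal_F_closed)

definition rel_eq :: "('x nek_gen, 'k::field) free_star \<Rightarrow> ('x nek_gen, 'k) free_star \<Rightarrow> bool"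
    (infix "\<sim>" 50) where
  "p \<sim> q \<longleftrightarrow> p \<in> carrier F \<and> q \<in> carrier F \<and> p - q \<in> I"

lemma rel_eq_refl: "p \<in> carrier F \<Longrightarrow> p \<sim> p"
  using I_closed(1) by (simp add: rel_eq_def)

lemma rel_eq_sym: "p \<sim> q \<Longrightarrow> q \<sim> p"
  using I_closed(3)[OF I_closed(1), of "p - q"] by (auto simp: rel_eq_def)

lemma rel_eq_trans [trans]: "p \<sim> q \<Longrightarrow> q \<sim> r \<Longrightarrow> p \<sim> r"
  using I_closed(4)[of "p - q" "q - r"] by (auto simp: rel_eq_def)

lemma rel_eq_mult:
  assumes "p \<sim> p'" "q \<sim> q'"
  shows "p * q \<sim> p' * q'"
proof -
  have "(p - p') * q + p' * (q - q') \<in> I"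
    using assms unfolding rel_eq_def by (intro I_closed(4,5,6)) auto
  then show ?thesis
    using assms unfolding rel_eq_def by (simp add: free_star_algebra_closed algebra_simps)
qed

lemma rel_eq_sum: "(\<And>b. b \<in> B \<Longrightarrow> f b \<sim> g b) \<Longrightarrow> sum f B \<sim> sum g B"
  using ideal_F_sum[OF ideal_I, of B "\<lambda>b. f b - g b"]
  by (auto simp: rel_eq_def sum_in_F sum_subtractf)

text \<open>With \<open>J = I\<close>, this says that being zero modulo the relators respects equality modulo them.\<close>

lemma rel_eq_ideal:
  assumes "ideal J F" "I \<subseteq> J" "p \<sim> q"
  shows "p \<in> J \<longleftrightarrow> q \<in> J"
proof -
  have "p - q \<in> J"
    using assms by (auto simp: rel_eq_def)
  then have "p \<in> J" if "q \<in> J"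
    using ideal_F_closed(4)[OF assms(1) _ that, of "p - q"] by simp
  moreover have "q \<in> J" if "p \<in> J"
    using ideal_F_closed(3)[OF assms(1) that, of "p - q"] \<open>p - q \<in> J\<close> by simp
  ultimately show ?thesis by blast
qed

lemma relator_rel_eq:
  assumes "p - q \<in> nek_relators A \<Gamma>" "p \<in> carrier F" "q \<in> carrier F"
  shows "p \<sim> q"
  using assms nek_relators_carrier[of "TYPE('k::field)"] free_star_algebra_closed(7)
    ring.genideal_self[OF ring_free_star_algebra, of "nek_relators A \<Gamma> \<union> star ` nek_relators A \<Gamma>"]
  unfolding rel_eq_def by blast

lemma basic_relations:
  shows one_rel: "(mon [Plain (Elem \<one>\<^bsub>BijGroup (lists A)\<^esub>)] :: ('x nek_gen, 'k::field) free_star) \<sim> mon []"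
    and inv_rel: "g \<in> \<Gamma> \<Longrightarrow>
      (mon [Adj (Elem g)] :: ('x nek_gen, 'k::field) free_star) \<sim> mon [Plain (Elem (inv\<^bsub>BijGroup (lists A)\<^esub> g))]"
    and mult_rel: "\<lbrakk>g \<in> \<Gamma>; h \<in> \<Gamma>\<rbrakk> \<Longrightarrow>
      (mon [Plain (Elem g), Plain (Elem h)] :: ('x nek_gen, 'k::field) free_star)
        \<sim> mon [Plain (Elem (g \<otimes>\<^bsub>BijGroup (lists A)\<^esub> h))]"
    and section_rel: "\<lbrakk>g \<in> \<Gamma>; x \<in> A\<rbrakk> \<Longrightarrow>
      (mon [Plain (Elem g), Plain (Letter x)] :: ('x nek_gen, 'k::field) free_star)
        \<sim> mon [Plain (Letter (hd (g [x]))), Plain (Elem (group_section A \<Gamma> g x))]"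
    and adj_letter_rel: "\<lbrakk>x \<in> A; y \<in> A\<rbrakk> \<Longrightarrow>
      (mon [Adj (Letter y), Plain (Letter x)] :: ('x nek_gen, 'k::field) free_star)
        \<sim> (if x = y then mon [] else 0)"
    and sum_rel: "(\<Sum>x\<in>A. mon [Plain (Letter x), Adj (Letter x)] :: ('x nek_gen, 'k::field) free_star) \<sim> mon []"
proof -
  let ?B = "BijGroup (lists A)"
  note simps = gen_def star_single mult_single adj_word_def plus_list_def
  note mon_Nil [simp]
  show "(mon [Plain (Elem \<one>\<^bsub>?B\<^esub>)] :: ('x nek_gen, 'k) free_star) \<sim> mon []"
    by (rule relator_rel_eq) (auto simp: nek_relators_def simps one_in intro!: single_in_F free_star_algebra_closed)
  show "(mon [Adj (Elem g)] :: ('x nek_gen, 'k) free_star) \<sim> mon [Plain (Elem (inv\<^bsub>?B\<^esub> g))]" if "g \<in> \<Gamma>"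
  proof (rule relator_rel_eq)
    have "star (gen (Elem g)) - gen (Elem (inv\<^bsub>?B\<^esub> g)) \<in> (nek_relators A \<Gamma> :: ('x nek_gen, 'k) free_star set)"
      using that unfolding nek_relators_def by blast
    then show "(mon [Adj (Elem g)] - mon [Plain (Elem (inv\<^bsub>?B\<^esub> g))] :: ('x nek_gen, 'k) free_star) \<in> nek_relators A \<Gamma>"
      by (simp add: simps)
  qed (use that inv_in in \<open>auto intro!: single_in_F\<close>)
  show "(mon [Plain (Elem g), Plain (Elem h)] :: ('x nek_gen, 'k) free_star)
      \<sim> mon [Plain (Elem (g \<otimes>\<^bsub>?B\<^esub> h))]" if "g \<in> \<Gamma>" "h \<in> \<Gamma>"
  proof (rule relator_rel_eq)
    have "gen (Elem g) * gen (Elem h) - gen (Elem (g \<otimes>\<^bsub>?B\<^esub> h)) \<in> (nek_relators A \<Gamma> :: ('x nek_gen, 'k) free_star set)"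
      using that unfolding nek_relators_def by blast
    then show "(mon [Plain (Elem g), Plain (Elem h)] - mon [Plain (Elem (g \<otimes>\<^bsub>?B\<^esub> h))]
        :: ('x nek_gen, 'k) free_star) \<in> nek_relators A \<Gamma>"
      by (simp add: simps)
  qed (use that mult_in in \<open>auto intro!: single_in_F\<close>)
  show "(mon [Plain (Elem g), Plain (Letter x)] :: ('x nek_gen, 'k) free_star)
      \<sim> mon [Plain (Letter (hd (g [x]))), Plain (Elem (group_section A \<Gamma> g x))]" if "g \<in> \<Gamma>" "x \<in> A"
  proof (rule relator_rel_eq)
    have "gen (Elem g) * gen (Letter x) - gen (Letter (hd (g [x]))) * gen (Elem (group_section A \<Gamma> g x))
        \<in> (nek_relators A \<Gamma> :: ('x nek_gen, 'k) free_star set)"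
      using that unfolding nek_relators_def by blast
    then show "(mon [Plain (Elem g), Plain (Letter x)] -
        mon [Plain (Letter (hd (g [x]))), Plain (Elem (group_section A \<Gamma> g x))]
        :: ('x nek_gen, 'k) free_star) \<in> nek_relators A \<Gamma>"
      by (simp add: simps)
  qed (use that perm_singleton(2) group_section_in in \<open>auto intro!: single_in_F\<close>)
  show "(mon [Adj (Letter y), Plain (Letter x)] :: ('x nek_gen, 'k) free_star)
      \<sim> (if x = y then mon [] else 0)" if "x \<in> A" "y \<in> A"
  proof (rule relator_rel_eq)
    have "star (gen (Letter y)) * gen (Letter x) - (if x = y then 1 else 0)
        \<in> (nek_relators A \<Gamma> :: ('x nek_gen, 'k) free_star set)"
      using that unfolding nek_relators_def by blast
    then show "(mon [Adj (Letter y), Plain (Letter x)] - (if x = y then mon [] else 0)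
        :: ('x nek_gen, 'k) free_star) \<in> nek_relators A \<Gamma>"
      by (cases "x = y") (simp_all add: simps)
  qed (use that in \<open>auto intro!: single_in_F free_star_algebra_closed\<close>)
  show "(\<Sum>x\<in>A. mon [Plain (Letter x), Adj (Letter x)] :: ('x nek_gen, 'k) free_star) \<sim> mon []"
  proof (rule relator_rel_eq)
    have "(\<Sum>x\<in>A. gen (Letter x) * star (gen (Letter x))) - 1
        \<in> (nek_relators A \<Gamma> :: ('x nek_gen, 'k) free_star set)"
      unfolding nek_relators_def by blast
    then show "((\<Sum>x\<in>A. mon [Plain (Letter x), Adj (Letter x)]) - mon []
        :: ('x nek_gen, 'k) free_star) \<in> nek_relators A \<Gamma>"
      by (simp add: simps)
  qed (auto intro!: single_in_F free_star_algebra_closed sum_in_F)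
qed

lemma rel_eq_context:
  assumes "(mon s :: ('x nek_gen, 'k::field) free_star) \<sim> q" "v \<in> lists alphabet" "w \<in> lists alphabet"
  shows "(mon (v @ s @ w) :: ('x nek_gen, 'k) free_star) \<sim> mon v * q * mon w"
  unfolding mon_append mult.assoc
  by (intro rel_eq_mult assms rel_eq_refl single_in_F)

lemma rel_eq_context_mon:
  assumes "(mon s :: ('x nek_gen, 'k::field) free_star) \<sim> mon t" "v \<in> lists alphabet" "w \<in> lists alphabet"
  shows "(mon (v @ s @ w) :: ('x nek_gen, 'k) free_star) \<sim> mon (v @ t @ w)"
  using rel_eq_context[OF assms] by (simp only: mon_append mult.assoc)

lemma elem_letters_rel:
  assumes "g \<in> \<Gamma>" "w \<in> lists A"
  shows "(mon (Plain (Elem g) # letters w) :: ('x nek_gen, 'k::field) free_star)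
    \<sim> mon (letters (g w) @ [Plain (Elem (word_section g w))])"
  using assms
proof (induction w arbitrary: g)
  case (Cons x w)
  let ?h = "group_section A \<Gamma> g x"
  have x: "x \<in> A" and w: "w \<in> lists A" and h: "?h \<in> \<Gamma>" and y: "hd (g [x]) \<in> A"
    using Cons.prems group_section_in perm_singleton(2) by auto
  have "(mon ([] @ [Plain (Elem g), Plain (Letter x)] @ letters w) :: ('x nek_gen, 'k) free_star)
      \<sim> mon ([] @ [Plain (Letter (hd (g [x]))), Plain (Elem ?h)] @ letters w)"
    by (rule rel_eq_context_mon[OF section_rel[OF Cons.prems(1) x]]) (use w in auto)
  also have "[] @ [Plain (Letter (hd (g [x]))), Plain (Elem ?h)] @ letters w =
      [Plain (Letter (hd (g [x])))] @ (Plain (Elem ?h) # letters w) @ []"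
    by simp
  also have "(mon \<dots> :: ('x nek_gen, 'k) free_star) \<sim>
      mon ([Plain (Letter (hd (g [x])))] @ (letters (?h w) @ [Plain (Elem (word_section ?h w))]) @ [])"
    by (rule rel_eq_context_mon[OF Cons.IH[OF h w]]) (use y in auto)
  also have "[Plain (Letter (hd (g [x])))] @ (letters (?h w) @ [Plain (Elem (word_section ?h w))]) @ [] =
      letters (g (x # w)) @ [Plain (Elem (word_section g (x # w)))]"
    by (simp only: group_section_apply[OF Cons.prems(1) x w] list.map append.simps append_Nil2 word_section.simps)
  finally show ?case by simp
qed (auto intro!: rel_eq_refl single_in_F)

lemma co_letters_letters_rel: "w \<in> lists A \<Longrightarrow>
  (mon (co_letters w @ letters w) :: ('x nek_gen, 'k::field) free_star) \<sim> mon []"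
proof (induction w)
  case (Cons x w)
  then have x: "x \<in> A" and w: "w \<in> lists A" by auto
  have "(mon (co_letters w @ [Adj (Letter x), Plain (Letter x)] @ letters w) :: ('x nek_gen, 'k) free_star)
      \<sim> mon (co_letters w @ [] @ letters w)"
    by (rule rel_eq_context_mon) (use adj_letter_rel[OF x x] w in auto)
  then show ?case
    using Cons.IH[OF w] by (simp del: single_one) (rule rel_eq_trans)
qed (auto intro!: rel_eq_refl single_in_F)

text \<open>
  Cancelling equal letters in the middle eventually meets two distinct ones, unless one of the words
  is used up before, that is, is a prefix of the other.
\<close>

lemma co_letters_letters_zero:
  "\<lbrakk>v \<in> lists A; w \<in> lists A; \<not> prefix v w; \<not> prefix w v\<rbrakk> \<Longrightarrow>
    (mon (co_letters v @ letters w) :: ('x nek_gen, 'k::field) free_star) \<sim> 0"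
proof (induction v arbitrary: w)
  case (Cons x v)
  then obtain y w' where w: "w = y # w'"
    by (cases w) auto
  have xy: "x \<in> A" "y \<in> A" "v \<in> lists A" "w' \<in> lists A"
    using Cons.prems w by auto
  have *: "(mon (co_letters v @ [Adj (Letter x), Plain (Letter y)] @ letters w') :: ('x nek_gen, 'k) free_star)
      \<sim> mon (co_letters v) * (if y = x then mon [] else 0) * mon (letters w')"
    by (rule rel_eq_context[OF adj_letter_rel[OF xy(2,1)]]) (use xy in auto)
  show ?case
  proof (cases "x = y")
    case True
    then have "(mon (co_letters v @ letters w') :: ('x nek_gen, 'k) free_star) \<sim> 0"
      using Cons.prems w xy by (intro Cons.IH) auto
    with * True show ?thesis
      unfolding w by (simp add: mon_Nil flip: mon_append del: single_one) (rule rel_eq_trans)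
  next
    case False
    with * show ?thesis unfolding w by simp
  qed
qed simp

end

section \<open>A criterion for simplicity\<close>

context self_similar_group
begin

definition normal_words :: "('x list \<Rightarrow> 'x list) set \<Rightarrow> 'x nek_gen starred list set" where
  "normal_words N = {letters u @ [Plain (Elem g)] | u g. u \<in> lists A \<and> g \<in> N}"

lemma normal_words_in: "N \<subseteq> \<Gamma> \<Longrightarrow> normal_words N \<subseteq> lists alphabet"
  by (auto simp: normal_words_def subset_eq)

lemma normal_word_mult_letters:
  assumes "u \<in> lists A" "g \<in> \<Gamma>" "w \<in> lists A"
  shows "(mon (letters u @ [Plain (Elem g)] @ letters w) :: ('x nek_gen, 'k::field) free_star)
    \<sim> mon (letters (u @ g w) @ [Plain (Elem (word_section g w))])"
proof -
  have "(mon (letters u @ (Plain (Elem g) # letters w) @ []) :: ('x nek_gen, 'k) free_star)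
      \<sim> mon (letters u @ (letters (g w) @ [Plain (Elem (word_section g w))]) @ [])"
    by (rule rel_eq_context_mon[OF elem_letters_rel[OF assms(2,3)]]) (use assms in auto)
  then show ?thesis by simp
qed

text \<open>
  An adjoint letter needs a letter to cancel against; the length condition says that there is one
  before the group element.
\<close>

lemma letter_mult_normal_word:
  assumes a: "a \<in> alphabet" and t: "t \<in> normal_words \<Gamma>"
    and long: "a \<in> range (\<lambda>x. Adj (Letter x)) \<Longrightarrow> length t \<ge> 2"
  shows "(mon (a # t) :: ('x nek_gen, 'k::field) free_star) \<sim> 0 \<or>
    (\<exists>t' \<in> normal_words \<Gamma>. (mon (a # t) :: ('x nek_gen, 'k) free_star) \<sim> mon t')"
proof -
  obtain u g where t: "t = letters u @ [Plain (Elem g)]" and u: "u \<in> lists A" and g: "g \<in> \<Gamma>"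
    using t unfolding normal_words_def by blast
  have t_in: "t \<in> lists alphabet"
    using t u g by auto
  have perm_letter: "\<exists>t' \<in> normal_words \<Gamma>. (mon (Plain (Elem h) # t) :: ('x nek_gen, 'k) free_star) \<sim> mon t'"
    if h: "h \<in> \<Gamma>" for h
  proof -
    let ?h = "word_section h u"
    have h': "?h \<in> \<Gamma>" and hu: "h u \<in> lists A"
      using word_section_in[OF h u] perm_closed[OF h u] .
    have "(mon ([] @ (Plain (Elem h) # letters u) @ [Plain (Elem g)]) :: ('x nek_gen, 'k) free_star)
        \<sim> mon ([] @ (letters (h u) @ [Plain (Elem ?h)]) @ [Plain (Elem g)])"
      by (rule rel_eq_context_mon[OF elem_letters_rel[OF h u]]) (use g in auto)
    also have "[] @ (letters (h u) @ [Plain (Elem ?h)]) @ [Plain (Elem g)] =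
        letters (h u) @ [Plain (Elem ?h), Plain (Elem g)] @ []"
      by simp
    also have "(mon \<dots> :: ('x nek_gen, 'k) free_star)
        \<sim> mon (letters (h u) @ [Plain (Elem (?h \<otimes>\<^bsub>BijGroup (lists A)\<^esub> g))] @ [])"
      by (rule rel_eq_context_mon[OF mult_rel[OF h' g]]) (use hu in auto)
    finally have "(mon (Plain (Elem h) # t) :: ('x nek_gen, 'k) free_star)
        \<sim> mon (letters (h u) @ [Plain (Elem (?h \<otimes>\<^bsub>BijGroup (lists A)\<^esub> g))])"
      by (simp add: t)
    moreover have "letters (h u) @ [Plain (Elem (?h \<otimes>\<^bsub>BijGroup (lists A)\<^esub> g))] \<in> normal_words \<Gamma>"
      unfolding normal_words_def using hu mult_in[OF h' g] by blast
    ultimately show ?thesis by blast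
  qed
  from a show ?thesis
  proof (cases a rule: alphabet_cases)
    case (letter x)
    then have "a # t = letters (x # u) @ [Plain (Elem g)]" "x # u \<in> lists A"
      using t u by auto
    then have "a # t \<in> normal_words \<Gamma>"
      unfolding normal_words_def using g by blast
    moreover have "(mon (a # t) :: ('x nek_gen, 'k) free_star) \<sim> mon (a # t)"
      by (intro rel_eq_refl single_in_F) (use a t_in in auto)
    ultimately show ?thesis by blast
  next
    case (adj_letter x)
    then obtain y u' where u': "u = y # u'"
      using long t by (cases u) auto
    then have y: "y \<in> A" "u' \<in> lists A"
      using u by auto
    have *: "(mon ([] @ [Adj (Letter x), Plain (Letter y)] @ letters u' @ [Plain (Elem g)]) :: ('x nek_gen, 'k) free_star)
        \<sim> mon [] * (if y = x then mon [] else 0) * mon (letters u' @ [Plain (Elem g)])"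
      by (rule rel_eq_context[OF adj_letter_rel[OF y(1) adj_letter(1)]]) (use y g in auto)
    show ?thesis
    proof (cases "y = x")
      case True
      have "letters u' @ [Plain (Elem g)] \<in> normal_words \<Gamma>"
        unfolding normal_words_def using y g by blast
      with * True show ?thesis
        unfolding t u' adj_letter(2) by (auto simp: mon_Nil)
    next
      case False
      with * show ?thesis
        unfolding t u' adj_letter(2) by simp
    qed
  next
    case (elem h)
    with perm_letter show ?thesis by blast
  next
    case (adj_elem h)
    obtain t' where t': "t' \<in> normal_words \<Gamma>"
      "(mon (Plain (Elem (inv\<^bsub>BijGroup (lists A)\<^esub> h)) # t) :: ('x nek_gen, 'k) free_star) \<sim> mon t'"
      using perm_letter[OF inv_in[OF adj_elem(1)]] by blast
    have "(mon ([] @ [Adj (Elem h)] @ t) :: ('x nek_gen, 'k) free_star)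
        \<sim> mon ([] @ [Plain (Elem (inv\<^bsub>BijGroup (lists A)\<^esub> h))] @ t)"
      by (rule rel_eq_context_mon[OF inv_rel[OF adj_elem(1)]]) (use t_in in auto)
    then have "(mon (a # t) :: ('x nek_gen, 'k) free_star)
        \<sim> mon (Plain (Elem (inv\<^bsub>BijGroup (lists A)\<^esub> h)) # t)"
      using adj_elem(2) by simp
    then show ?thesis
      using t' rel_eq_trans by blast
  qed
qed

text \<open>
  By induction on the word \<open>s\<close>, each of whose generators is pushed to the right through a normal word.
  Every generator may need one more letter on the right than the previous ones.
\<close>

lemma word_mult_letters_normal:
  assumes "s \<in> lists alphabet"
  shows "\<exists>n. \<forall>w\<in>lists A. n \<le> length w \<longrightarrow>
    (mon (s @ letters w) :: ('x nek_gen, 'k::field) free_star) \<sim> 0 \<or>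
    (\<exists>t\<in>normal_words \<Gamma>. (mon (s @ letters w) :: ('x nek_gen, 'k) free_star) \<sim> mon t)"
  using assms
proof (induction s)
  case Nil
  have "\<exists>t\<in>normal_words \<Gamma>. (mon ([] @ letters w) :: ('x nek_gen, 'k) free_star) \<sim> mon t"
    if w: "w \<in> lists A" for w
  proof
    show "letters w @ [Plain (Elem \<one>\<^bsub>BijGroup (lists A)\<^esub>)] \<in> normal_words \<Gamma>"
      unfolding normal_words_def using w one_in by blast
    have "(mon (letters w @ [Plain (Elem \<one>\<^bsub>BijGroup (lists A)\<^esub>)] @ []) :: ('x nek_gen, 'k) free_star)
        \<sim> mon (letters w @ [] @ [])"
      by (rule rel_eq_context_mon[OF one_rel]) (use w in auto)
    then show "(mon ([] @ letters w) :: ('x nek_gen, 'k) free_star)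
        \<sim> mon (letters w @ [Plain (Elem \<one>\<^bsub>BijGroup (lists A)\<^esub>)])"
      by (simp del: in_lists_conv_set) (rule rel_eq_sym)
  qed
  then show ?case by blast
next
  case (Cons a s)
  then have a: "a \<in> alphabet" by simp
  from Cons.IH obtain n where n: "\<And>w. \<lbrakk>w \<in> lists A; n \<le> length w\<rbrakk> \<Longrightarrow>
      (mon (s @ letters w) :: ('x nek_gen, 'k) free_star) \<sim> 0 \<or>
      (\<exists>t\<in>normal_words \<Gamma>. (mon (s @ letters w) :: ('x nek_gen, 'k) free_star) \<sim> mon t)"
    by blast
  have mon_a: "(mon [a] :: ('x nek_gen, 'k) free_star) \<sim> mon [a]"
    by (intro rel_eq_refl single_in_F) (use a in auto)
  have mult_a: "(mon (a # v) :: ('x nek_gen, 'k) free_star) = mon [a] * mon v" for v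
    by (simp flip: mon_append)
  show ?case
  proof (intro exI[of _ "Suc n"] ballI impI)
    fix w assume w: "w \<in> lists A" "Suc n \<le> length w"
    then obtain w' y where w': "w = w' @ [y]"
      by (cases w rule: rev_cases) auto
    then have w'_in: "w' \<in> lists A" "y \<in> A" "n \<le> length w'"
      using w by auto
    have mon_y: "(mon [Plain (Letter y)] :: ('x nek_gen, 'k) free_star) \<sim> mon [Plain (Letter y)]"
      by (intro rel_eq_refl single_in_F) (use w'_in in auto)
    have split: "(mon ((a # s) @ letters w) :: ('x nek_gen, 'k) free_star) =
        mon [a] * (mon (s @ letters w') * mon [Plain (Letter y)])"
      by (simp add: w' flip: mon_append)
    from n[OF w'_in(1,3)]
    show "(mon ((a # s) @ letters w) :: ('x nek_gen, 'k) free_star) \<sim> 0 \<or>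
        (\<exists>t\<in>normal_words \<Gamma>. (mon ((a # s) @ letters w) :: ('x nek_gen, 'k) free_star) \<sim> mon t)"
    proof (elim disjE bexE)
      assume "(mon (s @ letters w') :: ('x nek_gen, 'k) free_star) \<sim> 0"
      from rel_eq_mult[OF mon_a rel_eq_mult[OF this mon_y]] show ?thesis
        unfolding split by simp
    next
      fix t assume t: "t \<in> normal_words \<Gamma>" "(mon (s @ letters w') :: ('x nek_gen, 'k) free_star) \<sim> mon t"
      obtain u g where ug: "t = letters u @ [Plain (Elem g)]" "u \<in> lists A" "g \<in> \<Gamma>"
        using t unfolding normal_words_def by blast
      let ?t = "letters (u @ g [y]) @ [Plain (Elem (word_section g [y]))]"
      have "(mon t * mon [Plain (Letter y)] :: ('x nek_gen, 'k) free_star) \<sim> mon ?t"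
        using normal_word_mult_letters[OF ug(2,3), of "[y]"] w'_in(2)
        by (simp add: ug(1) flip: mon_append)
      from rel_eq_trans[OF rel_eq_mult[OF t(2) mon_y] this]
      have eq: "(mon ((a # s) @ letters w) :: ('x nek_gen, 'k) free_star) \<sim> mon (a # ?t)"
        unfolding split mult_a[of ?t] by (rule rel_eq_mult[OF mon_a])
      have "u @ g [y] \<in> lists A" "word_section g [y] \<in> \<Gamma>"
        using ug perm_closed[OF ug(3), of "[y]"] word_section_in[OF ug(3), of "[y]"] w'_in(2) by auto
      then have "?t \<in> normal_words \<Gamma>"
        unfolding normal_words_def by blast
      moreover have "length ?t \<ge> 2"
        using length_preserving[OF ug(3), of "[y]"] w'_in(2) by simp
      ultimately have "(mon (a # ?t) :: ('x nek_gen, 'k) free_star) \<sim> 0 \<or>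
          (\<exists>t'\<in>normal_words \<Gamma>. (mon (a # ?t) :: ('x nek_gen, 'k) free_star) \<sim> mon t')"
        by (intro letter_mult_normal_word[OF a])
      then show ?thesis
        using rel_eq_trans[OF eq] by blast
    qed
  qed
qed

text \<open>
  If all \<open>q x\<close> were zero modulo the relators, then so would be the sum of the \<open>q x x\<^sup>*\<close>, which is \<open>q\<close>.
\<close>

lemma notin_I_mult_letters:
  assumes "p \<in> carrier F" "p \<notin> (I :: ('x nek_gen, 'k::field) free_star set)"
  shows "\<exists>w\<in>lists A. length w = n \<and> p * mon (letters w) \<notin> I"
proof (induction n)
  case 0
  then show ?case
    using assms by (intro bexI[of _ "[]"]) (simp_all add: mon_Nil del: single_one)
next
  case (Suc n)
  then obtain w where w: "w \<in> lists A" "length w = n" and notin: "p * mon (letters w) \<notin> I"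
    by blast
  let ?q = "p * mon (letters w)"
  have q: "?q \<in> carrier F"
    using assms(1) w by (intro free_star_algebra_closed single_in_F) auto
  have "\<exists>x\<in>A. ?q * mon [Plain (Letter x)] \<notin> I"
  proof (rule ccontr)
    assume *: "\<not> ?thesis"
    have "(?q * mon [Plain (Letter x)]) * mon [Adj (Letter x)] \<in> I" if "x \<in> A" for x
    proof (rule I_closed(5))
      show "?q * mon [Plain (Letter x)] \<in> I"
        using that * by blast
    qed (use that in \<open>auto intro: single_in_F\<close>)
    then have "(\<Sum>x\<in>A. (?q * mon [Plain (Letter x)]) * mon [Adj (Letter x)]) \<in> I"
      by (rule ideal_F_sum[OF ideal_I])
    then have "?q * (\<Sum>x\<in>A. mon [Plain (Letter x), Adj (Letter x)]) \<in> I"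
      by (simp add: sum_distrib_left mult.assoc flip: mon_append)
    moreover have "?q * (\<Sum>x\<in>A. mon [Plain (Letter x), Adj (Letter x)]) \<sim> ?q * mon []"
      by (intro rel_eq_mult rel_eq_refl q sum_rel)
    ultimately show False
      using notin rel_eq_ideal[OF ideal_I subset_refl] by (simp only: mon_Nil mult_1_right) blast
  qed
  then obtain x where "x \<in> A" "p * mon (letters (w @ [x])) \<notin> I"
    by (auto simp: mult.assoc simp flip: mon_append)
  then show ?case
    using w by (intro bexI[of _ "w @ [x]"]) auto
qed

text \<open>
  Scalars are written as multiples of the empty word, so that congruence modulo the relators applies
  to them as to any other factor.
\<close>

lemma rel_eq_word_combination:
  fixes p q :: "('x nek_gen, 'k::field) free_star"
  assumes p: "p \<in> carrier F" and "\<And>s. s \<in> Poly_Mapping.keys p \<Longrightarrow> v * mon s * q \<sim> f s"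
  shows "v * p * q \<sim> (\<Sum>s\<in>Poly_Mapping.keys p. Poly_Mapping.single [] (Poly_Mapping.lookup p s) * f s)"
proof -
  let ?c = "\<lambda>s. Poly_Mapping.single [] (Poly_Mapping.lookup p s) :: ('x nek_gen, 'k) free_star"
  have central: "v * Poly_Mapping.single [] c = Poly_Mapping.single [] c * v" for v :: "('x nek_gen, 'k) free_star" and c
    by (induction v rule: free_star_induct)
      (simp_all add: distrib_left distrib_right mult_single plus_list_def mult.commute)
  have "v * p * q = v * (\<Sum>s\<in>Poly_Mapping.keys p. ?c s * mon s) * q"
    by (simp only: sum_monomials single_eq_scalar_mult[symmetric])
  also have "\<dots> = (\<Sum>s\<in>Poly_Mapping.keys p. ?c s * (v * mon s * q))"
    by (simp add: sum_distrib_left sum_distrib_right mult.assoc[symmetric] central del: mult_single)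
  also have "\<dots> \<sim> (\<Sum>s\<in>Poly_Mapping.keys p. ?c s * f s)"
    by (intro rel_eq_sum rel_eq_mult rel_eq_refl single_in_F assms(2)) auto
  finally show ?thesis .
qed

lemma notin_I_normalise:
  fixes p :: "('x nek_gen, 'k::field) free_star"
  assumes p: "p \<in> carrier F" "p \<notin> I" and T: "T \<subseteq> lists alphabet"
    and words: "\<And>s. s \<in> Poly_Mapping.keys p \<Longrightarrow> \<exists>n. \<forall>w\<in>lists A. n \<le> length w \<longrightarrow>
      (mon (s @ letters w) :: ('x nek_gen, 'k::field) free_star) \<sim> 0 \<or>
      (\<exists>t\<in>T. (mon (s @ letters w) :: ('x nek_gen, 'k) free_star) \<sim> mon t)"
  shows "\<exists>w\<in>lists A. \<exists>q. p * mon (letters w) \<sim> q \<and> q \<notin> I \<and> Poly_Mapping.keys q \<subseteq> T"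
proof -
  obtain n where n: "\<And>s w. \<lbrakk>s \<in> Poly_Mapping.keys p; w \<in> lists A; n s \<le> length w\<rbrakk> \<Longrightarrow>
      (mon (s @ letters w) :: ('x nek_gen, 'k) free_star) \<sim> 0 \<or>
      (\<exists>t\<in>T. (mon (s @ letters w) :: ('x nek_gen, 'k) free_star) \<sim> mon t)"
    using words by metis
  obtain N where N: "\<And>s. s \<in> Poly_Mapping.keys p \<Longrightarrow> n s \<le> N"
    using finite_keys[of p] by (metis Max_ge finite_imageI imageI)
  obtain w where w: "w \<in> lists A" "length w = N" "p * mon (letters w) \<notin> I"
    using notin_I_mult_letters[OF p] by blast
  have "\<exists>r :: ('x nek_gen, 'k) free_star. mon s * mon (letters w) \<sim> r \<and> Poly_Mapping.keys r \<subseteq> T"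
    if s: "s \<in> Poly_Mapping.keys p" for s
  proof -
    from n[OF s w(1)] N[OF s] w(2)
    consider "(mon (s @ letters w) :: ('x nek_gen, 'k) free_star) \<sim> 0"
      | t where "t \<in> T" "(mon (s @ letters w) :: ('x nek_gen, 'k) free_star) \<sim> mon t"
      by blast
    then show ?thesis
    proof cases
      case 1
      then show ?thesis
        by (intro exI[of _ 0]) (simp add: mon_append)
    next
      case (2 t)
      then show ?thesis
        by (intro exI[of _ "mon t"]) (simp add: mon_append)
    qed
  qed
  then obtain r :: "_ \<Rightarrow> ('x nek_gen, 'k) free_star" where r: "\<And>s. s \<in> Poly_Mapping.keys p \<Longrightarrow> mon s * mon (letters w) \<sim> r s"
    "\<And>s. s \<in> Poly_Mapping.keys p \<Longrightarrow> Poly_Mapping.keys (r s) \<subseteq> T"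
    by metis
  define q where "q = (\<Sum>s\<in>Poly_Mapping.keys p. Poly_Mapping.single [] (Poly_Mapping.lookup p s) * r s)"
  have pq: "p * mon (letters w) \<sim> q"
    using rel_eq_word_combination[OF p(1), of 1] r(1) unfolding q_def by simp
  moreover have "Poly_Mapping.keys q \<subseteq> T"
  proof -
    have "Poly_Mapping.keys (Poly_Mapping.single [] c * r s) \<subseteq> T" if "s \<in> Poly_Mapping.keys p" for s c
      using keys_mult[of "Poly_Mapping.single [] c" "r s"] r(2)[OF that]
      by (auto simp: plus_list_def split: if_splits)
    then have "(\<Union>s\<in>Poly_Mapping.keys p.
        Poly_Mapping.keys (Poly_Mapping.single [] (Poly_Mapping.lookup p s) * r s)) \<subseteq> T"
      by (intro UN_least)
    with keys_sum show ?thesis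
      unfolding q_def by (rule subset_trans)
  qed
  ultimately show ?thesis
    using w(1,3) rel_eq_ideal[OF ideal_I subset_refl pq] by blast
qed

text \<open>
  If \<open>u\<close> is shorter than \<open>v\<close>, then the final \<open>d\<close> of the extension of \<open>u\<close> is at a position where the
  extension of \<open>v\<close> has one of its letters \<open>c\<close>, since \<open>n\<close> is large.
\<close>

lemma prefix_free_extension:
  assumes cd: "c \<noteq> d" and len: "length u \<le> n" "length v \<le> n"
    and pre: "prefix (u @ replicate n c @ [d]) (v @ replicate n c @ [d])"
  shows "u = v"
proof -
  obtain t where t: "v @ replicate n c @ [d] = (u @ replicate n c @ [d]) @ t"
    using pre by (auto simp: prefix_def)
  have "length u \<le> length v"
    using arg_cong[OF t, of length] by simp
  moreover have "\<not> length u < length v"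
  proof
    assume "length u < length v"
    let ?i = "length u + n"
    have "((u @ replicate n c @ [d]) @ t) ! ?i = d"
      by (simp add: nth_append)
    moreover have "(v @ replicate n c @ [d]) ! ?i = c"
    proof -
      have "?i - length v < n" "\<not> ?i < length v"
        using \<open>length u < length v\<close> len by linarith+
      then show ?thesis by (simp add: nth_append)
    qed
    ultimately show False
      unfolding t using cd by simp
  qed
  ultimately show ?thesis
    using t by simp
qed

text \<open>
  Appending \<open>c\<^sup>n d\<close> to the words makes them pairwise incomparable in the prefix order, even if they
  have different lengths. Multiplication by the adjoint of one of them then kills all others and
  leaves a nonzero scalar.
\<close>

lemma one_in_ideal_if_letters:
  fixes r :: "('x nek_gen, 'k::field) free_star"
  assumes J: "ideal J F" "I \<subseteq> J" and r: "r \<in> J" "r \<noteq> 0"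
    and keys: "Poly_Mapping.keys r \<subseteq> letters ` lists A"
  shows "1 \<in> J"
proof -
  obtain c d where cd: "c \<in> A" "d \<in> A" "c \<noteq> d"
    using card_alphabet by (metis card_2_iff' card_le_Suc0_iff_eq finite_alphabet not_less_eq_eq numeral_2_eq_2)
  obtain s0 where s0: "s0 \<in> Poly_Mapping.keys r"
    using r(2) by (metis keys_eq_empty ex_in_conv)
  define n where "n = Max (length ` Poly_Mapping.keys r)"
  have n: "length s \<le> n" if "s \<in> Poly_Mapping.keys r" for s
    unfolding n_def by (rule Max_ge) (use that in auto)
  let ?v = "replicate n c @ [d]"
  have v: "?v \<in> lists A"
    using cd by auto
  obtain u0 where u0: "s0 = letters u0" "u0 \<in> lists A"
    using s0 keys by blast
  let ?a = "mon (co_letters (u0 @ ?v)) :: ('x nek_gen, 'k) free_star"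
  let ?b = "mon (letters ?v) :: ('x nek_gen, 'k) free_star"
  have words: "?a * mon s * ?b \<sim> (if s = s0 then mon [] else 0)"
    if s: "s \<in> Poly_Mapping.keys r" for s
  proof -
    obtain u where u: "s = letters u" "u \<in> lists A"
      using s keys by blast
    have eq: "?a * mon s * ?b = mon (co_letters (u0 @ ?v) @ letters (u @ ?v))"
      by (simp add: u flip: mon_append)
    show ?thesis
    proof (cases "u = u0")
      case True
      have "(mon (co_letters (u0 @ ?v) @ letters (u0 @ ?v)) :: ('x nek_gen, 'k) free_star) \<sim> mon []"
        by (rule co_letters_letters_rel) (use u0 v in simp)
      then show ?thesis
        unfolding eq using True u u0 by simp
    next
      case False
      have "length u \<le> n" "length u0 \<le> n"
        using n[OF s] n[OF s0] u u0 by auto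
      then have "\<not> prefix (u0 @ ?v) (u @ ?v)" "\<not> prefix (u @ ?v) (u0 @ ?v)"
        using prefix_free_extension[OF cd(3), of u n u0] prefix_free_extension[OF cd(3), of u0 n u] False
        by blast+
      then have "(mon (co_letters (u0 @ ?v) @ letters (u @ ?v)) :: ('x nek_gen, 'k) free_star) \<sim> 0"
        by (intro co_letters_letters_zero) (use u u0 v in simp_all)
      moreover have "s \<noteq> s0"
        using False u u0 by (auto simp: inj_def dest!: map_injective)
      ultimately show ?thesis
        unfolding eq by simp
    qed
  qed
  let ?c = "Poly_Mapping.lookup r s0"
  have r_in: "r \<in> carrier F"
    using r(1) ideal_F_closed(2)[OF J(1)] by blast
  have "?a * r * ?b \<sim> (\<Sum>s\<in>Poly_Mapping.keys r. Poly_Mapping.single [] (Poly_Mapping.lookup r s) *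
      (if s = s0 then mon [] else 0))"
    by (rule rel_eq_word_combination[OF r_in words])
  also have "\<dots> = (\<Sum>s\<in>Poly_Mapping.keys r. if s = s0 then Poly_Mapping.single [] ?c else 0)"
    by (intro sum.cong) (auto simp: mult_single plus_list_def)
  also have "\<dots> = Poly_Mapping.single [] ?c"
    using s0 by simp
  finally have "Poly_Mapping.single [] ?c \<in> J \<longleftrightarrow> ?a * r * ?b \<in> J"
    using rel_eq_ideal[OF J] by blast
  moreover have "?a * r * ?b \<in> J"
    by (intro ideal_F_closed(5,6)[OF J(1)] r(1) single_in_F) (use u0 v in auto)
  ultimately have "Poly_Mapping.single [] (inverse ?c) * Poly_Mapping.single [] ?c \<in> J"
    by (intro ideal_F_closed(6)[OF J(1)] single_in_F) auto
  moreover have "?c \<noteq> 0"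
    using s0 by (simp add: in_keys_iff)
  ultimately show ?thesis
    by (simp add: mult_single plus_list_def mon_Nil)
qed

text \<open>
  The last two assumptions say that multiplication by \<open>z\<close> turns the elements of \<open>N\<close> into pairwise
  distinct words of letters. Together with \<open>length_preserving\<close>, this makes the map \<open>u g \<mapsto> u g(z)\<close> on
  normal words injective, so that no coefficients cancel.
\<close>

theorem simple_nekrashevych_algebra_if_separated:
  assumes N: "N \<subseteq> \<Gamma>"
    and contracting: "\<And>g. g \<in> \<Gamma> \<Longrightarrow> \<exists>n. \<forall>w\<in>lists A. n \<le> length w \<longrightarrow> word_section g w \<in> N"
    and z: "z \<in> lists A" "\<And>g. g \<in> N \<Longrightarrow> word_section g z = \<one>\<^bsub>BijGroup (lists A)\<^esub>"
    and separated: "inj_on (\<lambda>g. g z) N"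
  shows "simple_ring (nekrashevych_algebra TYPE('k::field) A \<Gamma>)"
  unfolding simple_nekrashevych_algebra_iff
proof (intro allI impI)
  fix J :: "('x nek_gen, 'k) free_star set"
  assume J: "ideal J F" and "I \<subset> J"
  then obtain p where p: "p \<in> J" "p \<notin> I" and IJ: "I \<subseteq> J"
    by blast
  note J_closed = ideal_F_closed[OF J]
  have J_carrier: "q \<in> carrier F" if "q \<in> J" for q
    using that J_closed(2) by blast
  have J_letters: "q * mon (letters w) \<in> J" if "q \<in> J" "w \<in> lists A" for q w
    by (intro J_closed(5) single_in_F) (use that in auto)
  obtain w p1 where w: "w \<in> lists A" "p * mon (letters w) \<sim> p1"
    and p1: "p1 \<notin> I" "Poly_Mapping.keys p1 \<subseteq> normal_words \<Gamma>"
    using notin_I_normalise[OF J_carrier[OF p(1)] p(2) normal_words_in[OF subset_refl]]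
      word_mult_letters_normal J_carrier[OF p(1), unfolded carrier_F_iff] by blast
  then have p1_in: "p1 \<in> J"
    using rel_eq_ideal[OF J IJ] J_letters[OF p(1)] by blast
  have "\<exists>n. \<forall>w\<in>lists A. n \<le> length w \<longrightarrow>
      (mon (s @ letters w) :: ('x nek_gen, 'k) free_star) \<sim> 0 \<or>
      (\<exists>t\<in>normal_words N. (mon (s @ letters w) :: ('x nek_gen, 'k) free_star) \<sim> mon t)"
    if s: "s \<in> Poly_Mapping.keys p1" for s
  proof -
    obtain u g where s: "s = letters u @ [Plain (Elem g)]" and ug: "u \<in> lists A" "g \<in> \<Gamma>"
      using s p1(2) unfolding normal_words_def by blast
    obtain n where n: "\<forall>w\<in>lists A. n \<le> length w \<longrightarrow> word_section g w \<in> N"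
      using contracting[OF ug(2)] by blast
    have "\<exists>t\<in>normal_words N. (mon (s @ letters w) :: ('x nek_gen, 'k) free_star) \<sim> mon t"
      if w: "w \<in> lists A" "n \<le> length w" for w
    proof
      have "u @ g w \<in> lists A"
        using ug(1) perm_closed[OF ug(2) w(1)] by simp
      then show "letters (u @ g w) @ [Plain (Elem (word_section g w))] \<in> normal_words N"
        unfolding normal_words_def using n w by blast
      show "(mon (s @ letters w) :: ('x nek_gen, 'k) free_star)
          \<sim> mon (letters (u @ g w) @ [Plain (Elem (word_section g w))])"
        using normal_word_mult_letters[OF ug w(1)] by (simp add: s)
    qed
    then show ?thesis by blast
  qed
  then obtain w q where w: "w \<in> lists A" "p1 * mon (letters w) \<sim> q"
    and q: "q \<notin> I" "Poly_Mapping.keys q \<subseteq> normal_words N"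
    using notin_I_normalise[OF J_carrier[OF p1_in] p1(1) normal_words_in[OF N]] by blast
  then have q_in: "q \<in> J"
    using rel_eq_ideal[OF J IJ] J_letters[OF p1_in] by blast
  have "\<forall>s\<in>Poly_Mapping.keys q. \<exists>u g. s = letters u @ [Plain (Elem g)] \<and> u \<in> lists A \<and> g \<in> N"
    using q(2) unfolding normal_words_def by blast
  then obtain u g where s_eq: "\<And>s. s \<in> Poly_Mapping.keys q \<Longrightarrow> s = letters (u s) @ [Plain (Elem (g s))]"
    and u: "\<And>s. s \<in> Poly_Mapping.keys q \<Longrightarrow> u s \<in> lists A"
    and g: "\<And>s. s \<in> Poly_Mapping.keys q \<Longrightarrow> g s \<in> N"
    by metis
  let ?f = "\<lambda>s. u s @ g s z"
  have f_in: "?f s \<in> lists A" if "s \<in> Poly_Mapping.keys q" for s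
    using u[OF that] perm_closed[OF _ z(1), of "g s"] g[OF that] N by auto
  have inj: "inj_on ?f (Poly_Mapping.keys q)"
  proof (rule inj_onI)
    fix s s' assume s: "s \<in> Poly_Mapping.keys q" and s': "s' \<in> Poly_Mapping.keys q" and eq: "?f s = ?f s'"
    have "length (g s z) = length z" "length (g s' z) = length z"
      using g[OF s] g[OF s'] N z(1) length_preserving by blast+
    then have "u s = u s'" "g s z = g s' z"
      using eq by auto
    then have "g s = g s'"
      using inj_onD[OF separated _ g[OF s] g[OF s']] by simp
    with \<open>u s = u s'\<close> show "s = s'"
      using s_eq[OF s] s_eq[OF s'] by simp
  qed
  define r where "r = (\<Sum>s\<in>Poly_Mapping.keys q. Poly_Mapping.single (letters (?f s)) (Poly_Mapping.lookup q s))"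
  have words: "1 * mon s * mon (letters z) \<sim> (mon (letters (?f s)) :: ('x nek_gen, 'k) free_star)"
    if s: "s \<in> Poly_Mapping.keys q" for s
  proof -
    have gs: "g s \<in> \<Gamma>"
      using g[OF s] N by blast
    have "(mon (s @ letters z) :: ('x nek_gen, 'k) free_star)
        \<sim> mon (letters (?f s) @ [Plain (Elem \<one>\<^bsub>BijGroup (lists A)\<^esub>)])"
      using normal_word_mult_letters[OF u[OF s] gs z(1)] unfolding z(2)[OF g[OF s]]
      by (subst s_eq[OF s]) simp
    also have "letters (?f s) @ [Plain (Elem \<one>\<^bsub>BijGroup (lists A)\<^esub>)] =
        letters (?f s) @ [Plain (Elem \<one>\<^bsub>BijGroup (lists A)\<^esub>)] @ []"
      by simp
    also have "(mon \<dots> :: ('x nek_gen, 'k) free_star)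
        \<sim> mon (letters (?f s) @ [] @ [])"
      by (rule rel_eq_context_mon[OF one_rel]) (use f_in[OF s] in auto)
    finally show ?thesis
      by (simp add: mon_append)
  qed
  have "1 * q * mon (letters z) \<sim> r"
    using rel_eq_word_combination[OF J_carrier[OF q_in] words]
    by (simp only: r_def single_eq_scalar_mult[symmetric])
  then have "r \<in> J"
    using rel_eq_ideal[OF J IJ] J_letters[OF q_in z(1)] by simp
  moreover have "Poly_Mapping.keys r \<subseteq> letters ` lists A"
  proof -
    have "Poly_Mapping.keys (Poly_Mapping.single (letters (?f s)) (Poly_Mapping.lookup q s)) \<subseteq> letters ` lists A"
      if "s \<in> Poly_Mapping.keys q" for s
      using imageI[OF f_in[OF that], of letters] by simp
    then have "(\<Union>s\<in>Poly_Mapping.keys q. Poly_Mapping.keys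
        (Poly_Mapping.single (letters (?f s)) (Poly_Mapping.lookup q s))) \<subseteq> letters ` lists A"
      by (rule UN_least)
    with keys_sum show ?thesis
      unfolding r_def by (rule subset_trans)
  qed
  moreover have "r \<noteq> 0"
  proof -
    have "q \<noteq> 0"
      using q(1) I_closed(1) by blast
    then obtain s0 where s0: "s0 \<in> Poly_Mapping.keys q"
 by (metis keys_eq_empty ex_in_conv)
    have "letters (?f s) = letters (?f s0) \<longleftrightarrow> ?f s = ?f s0" for s
      by (rule inj_map_eq_map) (simp add: inj_def)
    then have "letters (?f s) = letters (?f s0) \<longleftrightarrow> s = s0" if "s \<in> Poly_Mapping.keys q" for s
      using inj_on_eq_iff[OF inj that s0] by (simp only:)
    then have "Poly_Mapping.lookup r (letters (?f s0)) =
        (\<Sum>s\<in>Poly_Mapping.keys q. if s = s0 then Poly_Mapping.lookup q s else 0)"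
      unfolding r_def lookup_sum lookup_single when_def
      by (intro sum.cong refl if_cong)
    then have "Poly_Mapping.lookup r (letters (?f s0)) \<noteq> 0"
      using s0 by (simp add: in_keys_iff)
    then show ?thesis by auto
  qed
  ultimately show "1 \<in> J"
    by (intro one_in_ideal_if_letters[OF J IJ])
qed

end

section \<open>GGS-groups contract to their generators\<close>

context ggs_data
begin

sublocale ssg: self_similar_group "carrier Z" "ggs_group G m \<Phi>"
  by (rule self_similar_ggs_group)

abbreviation perm_of_G :: "'g \<Rightarrow> int list \<Rightarrow> int list" where
  "perm_of_G g \<equiv> restrict (act_G m \<Phi> g) W"

abbreviation perm_of_H :: "int \<Rightarrow> int list \<Rightarrow> int list" where
  "perm_of_H h \<equiv> restrict (act_H m h) W"

lemma mem_Z: "x \<in> carrier Z \<longleftrightarrow> 0 \<le> x \<and> x < int m"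
  using m_ge_2 by (auto simp: carrier_integer_mod_group)

lemma gens_in_ggs: "gens \<subseteq> ggs_group G m \<Phi>"
  unfolding ggs_group_eq by (auto intro: generate.incl)

lemma perm_of_G_in_gens: "g \<in> carrier G \<Longrightarrow> perm_of_G g \<in> gens"
  and perm_of_H_in_gens: "h \<in> carrier Z \<Longrightarrow> perm_of_H h \<in> gens"
  by (auto simp: gens_def)

lemma gens_cases [consumes 1, case_names G H]:
  assumes "f \<in> gens"
  obtains g where "g \<in> carrier G" "f = perm_of_G g" | h where "h \<in> carrier Z" "f = perm_of_H h"
  using assms unfolding gens_def by blast

lemma perm_of_one:
  "perm_of_G \<one> = \<one>\<^bsub>BijGroup W\<^esub>" "perm_of_H 0 = \<one>\<^bsub>BijGroup W\<^esub>"
proof -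
  have H: "act_H m 0 w = w" if "w \<in> W" for w
    using act_H_one[OF that] by simp
  have one: "\<one>\<^bsub>BijGroup W\<^esub> = restrict (\<lambda>w. w) W"
    by (simp add: BijGroup_def)
  show "perm_of_G \<one> = \<one>\<^bsub>BijGroup W\<^esub>" "perm_of_H 0 = \<one>\<^bsub>BijGroup W\<^esub>"
    unfolding one by (rule restrict_ext, erule act_G_one, rule restrict_ext, erule H)
qed

lemma one_in_gens: "\<one>\<^bsub>BijGroup W\<^esub> \<in> gens"
  using perm_of_G_in_gens[OF one_closed] by (simp only: perm_of_one)

lemma group_section_perm_of_G:
  assumes "g \<in> carrier G" "x \<in> carrier Z"
  shows "group_section (carrier Z) (ggs_group G m \<Phi>) (perm_of_G g) x =
    (if x = int m - 1 then perm_of_G g else perm_of_H (\<Phi> x g))"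
proof (rule ssg.group_section_eqI)
  show "(if x = int m - 1 then perm_of_G g else perm_of_H (\<Phi> x g)) \<in> ggs_group G m \<Phi>"
    using assms Phi_closed perm_of_G_in_gens perm_of_H_in_gens gens_in_ggs by auto
  show "perm_of_G g \<in> ggs_group G m \<Phi>"
    using assms perm_of_G_in_gens gens_in_ggs by blast
qed (use assms in auto)

lemma group_section_perm_of_H:
  assumes "h \<in> carrier Z" "x \<in> carrier Z"
  shows "group_section (carrier Z) (ggs_group G m \<Phi>) (perm_of_H h) x = \<one>\<^bsub>BijGroup W\<^esub>"
proof (rule ssg.group_section_eqI)
  show "perm_of_H h \<in> ggs_group G m \<Phi>"
    using assms perm_of_H_in_gens gens_in_ggs by blast
  show "perm_of_H h (x # w) = perm_of_H h [x] @ \<one>\<^bsub>BijGroup W\<^esub> w" if "w \<in> W" for w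
    using assms that by (simp add: BijGroup_def)
qed (use assms ssg.one_in in auto)

lemma group_section_gens:
  assumes "f \<in> gens" "x \<in> carrier Z"
  shows "group_section (carrier Z) (ggs_group G m \<Phi>) f x \<in> gens"
  using assms(1)
proof (cases f rule: gens_cases)
  case (G g)
  then show ?thesis
    using group_section_perm_of_G[OF G(1) assms(2)] assms(2)
      perm_of_G_in_gens perm_of_H_in_gens[OF Phi_closed] by auto
next
  case (H h)
  then show ?thesis
    using group_section_perm_of_H[OF H(1) assms(2)] one_in_gens by simp
qed

lemma word_section_gens: "\<lbrakk>f \<in> gens; w \<in> W\<rbrakk> \<Longrightarrow> ssg.word_section f w \<in> gens"
  by (induction w arbitrary: f) (auto simp: group_section_gens)

text \<open>
  Sections of elements of \<open>H\<close> are trivial, so a product with a factor in \<open>H\<close> has the sections of the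
  other factor. A product of two elements of \<open>G\<close> is in \<open>G\<close>.
\<close>

lemma group_section_gens_mult:
  assumes f: "f \<in> gens" and k: "k \<in> gens" and x: "x \<in> carrier Z"
  shows "group_section (carrier Z) (ggs_group G m \<Phi>) (f \<otimes>\<^bsub>BijGroup W\<^esub> k) x \<in> gens"
proof -
  interpret B: group "BijGroup W"
    by (rule group_BijGroup)
  have fk: "f \<in> ggs_group G m \<Phi>" "k \<in> ggs_group G m \<Phi>"
    using f k gens_in_ggs by auto
  obtain y where y: "k [x] = [y]" "y \<in> carrier Z"
    using ssg.perm_singleton[OF fk(2) x] by blast
  have split: "group_section (carrier Z) (ggs_group G m \<Phi>) (f \<otimes>\<^bsub>BijGroup W\<^esub> k) x =
      group_section (carrier Z) (ggs_group G m \<Phi>) f y \<otimes>\<^bsub>BijGroup W\<^esub>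
      group_section (carrier Z) (ggs_group G m \<Phi>) k x"
    using ssg.word_section_mult[OF fk, of "[x]"] x y(1) by simp
  have sections: "group_section (carrier Z) (ggs_group G m \<Phi>) f y \<in> gens"
    "group_section (carrier Z) (ggs_group G m \<Phi>) k x \<in> gens"
    by (intro group_section_gens f k x y(2))+
  then have in_carrier: "group_section (carrier Z) (ggs_group G m \<Phi>) f y \<in> carrier (BijGroup W)"
    "group_section (carrier Z) (ggs_group G m \<Phi>) k x \<in> carrier (BijGroup W)"
    using gens_subset by blast+
  from f show ?thesis
  proof (cases f rule: gens_cases)
    case (H h)
    then have "group_section (carrier Z) (ggs_group G m \<Phi>) f y = \<one>\<^bsub>BijGroup W\<^esub>"
      using group_section_perm_of_H[OF H(1) y(2)] by simp
    then show ?thesis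
      using sections(2) in_carrier(2) unfolding split by simp
  next
    case f: (G g)
    from k show ?thesis
    proof (cases k rule: gens_cases)
      case (H h)
      then have "group_section (carrier Z) (ggs_group G m \<Phi>) k x = \<one>\<^bsub>BijGroup W\<^esub>"
        using group_section_perm_of_H[OF H(1) x] by simp
      then show ?thesis
        using sections(1) in_carrier(1) unfolding split by simp
    next
      case (G g')
      have "f \<otimes>\<^bsub>BijGroup W\<^esub> k = perm_of_G (g \<otimes> g')"
      proof (rule ssg.perm_eqI)
        show "f \<otimes>\<^bsub>BijGroup W\<^esub> k \<in> ggs_group G m \<Phi>"
          by (rule ssg.mult_in[OF fk])
        show "perm_of_G (g \<otimes> g') \<in> ggs_group G m \<Phi>"
          using perm_of_G_in_gens f G gens_in_ggs by blast
        show "(f \<otimes>\<^bsub>BijGroup W\<^esub> k) w = perm_of_G (g \<otimes> g') w" if "w \<in> W" for w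
        proof -
          have "(f \<otimes>\<^bsub>BijGroup W\<^esub> k) w = perm_of_G g (perm_of_G g' w)"
            unfolding f(2)[symmetric] G(2)[symmetric] by (rule ssg.mult_apply[OF fk that])
          also have "\<dots> = perm_of_G (g \<otimes> g') w"
            by (simp only: restrict_apply' that act_G_closed[OF G(1) that] act_G_mult[OF f(1) G(1) that])
          finally show ?thesis .
        qed
      qed
      then show ?thesis
        using group_section_gens[OF perm_of_G_in_gens[OF m_closed[OF f(1) G(1)]] x] by (simp only:)
    qed
  qed
qed

text \<open>
  This property passes to products: deep sections of a product are products of two generators, and
  one further letter leads back to generators.
\<close>

lemma ggs_contracting:
  assumes "f \<in> ggs_group G m \<Phi>"
  shows "\<exists>n. \<forall>w\<in>W. n \<le> length w \<longrightarrow> ssg.word_section f w \<in> gens"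
  using assms[unfolded ggs_group_eq]
proof (induction f rule: generate.induct)
  case one
  show ?case
    by (intro exI[of _ 0] ballI impI word_section_gens one_in_gens)
next
  case (incl f)
  then show ?case
    by (intro exI[of _ 0] ballI impI word_section_gens)
next
  case (inv f)
  then show ?case
    by (intro exI[of _ 0] ballI impI word_section_gens inv_gens)
next
  case (eng f k)
  then have fk: "f \<in> ggs_group G m \<Phi>" "k \<in> ggs_group G m \<Phi>"
    by (simp_all add: ggs_group_eq)
  from eng.IH obtain n n' where n: "\<And>w. \<lbrakk>w \<in> W; n \<le> length w\<rbrakk> \<Longrightarrow> ssg.word_section f w \<in> gens"
    and n': "\<And>w. \<lbrakk>w \<in> W; n' \<le> length w\<rbrakk> \<Longrightarrow> ssg.word_section k w \<in> gens"
    by blast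
  have "ssg.word_section (f \<otimes>\<^bsub>BijGroup W\<^esub> k) w \<in> gens" if w: "w \<in> W" "Suc (max n n') \<le> length w" for w
  proof -
    obtain v x where v: "w = v @ [x]"
      using w(2) by (cases w rule: rev_cases) auto
    then have v_in: "v \<in> W" "x \<in> carrier Z" "n \<le> length v" "n' \<le> length v"
      using w by auto
    have "ssg.word_section (f \<otimes>\<^bsub>BijGroup W\<^esub> k) w =
        group_section (carrier Z) (ggs_group G m \<Phi>) (ssg.word_section (f \<otimes>\<^bsub>BijGroup W\<^esub> k) v) x"
      by (simp add: v ssg.word_section_append)
    moreover have "ssg.word_section (f \<otimes>\<^bsub>BijGroup W\<^esub> k) v =
        ssg.word_section f (k v) \<otimes>\<^bsub>BijGroup W\<^esub> ssg.word_section k v"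
      by (rule ssg.word_section_mult[OF fk v_in(1)])
    moreover have "ssg.word_section f (k v) \<in> gens"
      by (rule n[OF ssg.perm_closed[OF fk(2) v_in(1)]])
        (use ssg.length_preserving[OF fk(2) v_in(1)] v_in(3) in simp)
    ultimately show ?thesis
      using group_section_gens_mult n'[OF v_in(1,4)] v_in(2) by simp
  qed
  then show ?case by blast
qed

lemma simple_if_iso:
  assumes k: "k \<in> {0..int m - 2}" and iso: "\<Phi> k \<in> iso G Z"
  shows "simple_ring (nekrashevych_algebra TYPE('k::field) (carrier Z) (ggs_group G m \<Phi>))"
proof (rule ssg.simple_nekrashevych_algebra_if_separated)
  have k': "k \<in> carrier Z" "k \<noteq> int m - 1" and zero: "0 \<in> carrier Z"
    using k m_ge_2 by (auto simp: mem_Z)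
  have inj: "inj_on (\<Phi> k) (carrier G)"
    using iso by (auto simp: iso_def bij_betw_def)
  show "gens \<subseteq> ggs_group G m \<Phi>"
    by (rule gens_in_ggs)
  show "\<exists>n. \<forall>w\<in>W. n \<le> length w \<longrightarrow> ssg.word_section f w \<in> gens" if "f \<in> ggs_group G m \<Phi>" for f
    by (rule ggs_contracting[OF that])
  show "[k, 0] \<in> W"
    using k' zero by simp
  have one_section: "group_section (carrier Z) (ggs_group G m \<Phi>) \<one>\<^bsub>BijGroup W\<^esub> 0 = \<one>\<^bsub>BijGroup W\<^esub>"
    using group_section_perm_of_H[OF zero zero] by (simp only: perm_of_one)
  show "ssg.word_section f [k, 0] = \<one>\<^bsub>BijGroup W\<^esub>" if "f \<in> gens" for f
    using that
  proof (cases f rule: gens_cases)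
    case (G g)
    then show ?thesis
      using group_section_perm_of_G[OF G(1) k'(1)] group_section_perm_of_H[OF Phi_closed[OF G(1) k'] zero] k'(2)
      by simp
  next
    case (H h)
    then show ?thesis
      using group_section_perm_of_H[OF H(1) k'(1)] one_section by simp
  qed
  have G_val: "perm_of_G g [k, 0] = [k, \<Phi> k g]" if "g \<in> carrier G" for g
    using k' zero Phi_closed[OF that k'] by (simp add: mem_Z)
  have H_val: "perm_of_H h [k, 0] = [(h + k) mod int m, 0]" for h
    using k' zero by simp
  have H_inj: "h = h'" if "(h + k) mod int m = (h' + k) mod int m" "h \<in> carrier Z" "h' \<in> carrier Z" for h h'
  proof -
    have "h mod int m = h' mod int m"
      using mod_diff_cong[OF that(1) refl[of "k mod int m"]] by simp
    then show ?thesis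
      using that(2,3) by (simp add: mem_Z)
  qed
  (* Equality of the values forces both permutations to be trivial. *)
  have GH: "perm_of_G g = perm_of_H h" if "g \<in> carrier G" "h \<in> carrier Z" "perm_of_G g [k, 0] = perm_of_H h [k, 0]" for g h
  proof -
    have *: "k = (h + k) mod int m" "\<Phi> k g = 0"
      using that(3) unfolding G_val[OF that(1)] H_val by auto
    have "h = 0"
      by (rule H_inj) (use * that(2) zero k'(1) in \<open>auto simp: mem_Z\<close>)
    moreover have "g = \<one>"
      by (rule inj_onD[OF inj _ that(1) one_closed]) (use *(2) Phi_one[OF k'] in simp)
    ultimately show ?thesis
      by (simp only: perm_of_one)
  qed
  show "inj_on (\<lambda>f. f [k, 0]) gens"
  proof (rule inj_onI)
    fix f f' assume f: "f \<in> gens" and f': "f' \<in> gens" and eq: "f [k, 0] = f' [k, 0]"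
    from f show "f = f'"
    proof (cases f rule: gens_cases)
      case g: (G g)
      from f' show ?thesis
      proof (cases f' rule: gens_cases)
        case (G g')
        then have "\<Phi> k g = \<Phi> k g'"
          using eq G_val g by simp
        then show ?thesis
          using inj_onD[OF inj] g G by blast
      next
        case (H h)
        then show ?thesis
          using GH[OF g(1) H(1)] eq g by blast
      qed
    next
      case h: (H h)
      from f' show ?thesis
      proof (cases f' rule: gens_cases)
        case (G g)
        then show ?thesis
          using GH[OF G(1) h(1)] eq h by metis
      next
        case (H h')
        then have "(h + k) mod int m = (h' + k) mod int m"
          using eq H_val h by simp
        then show ?thesis
          using H_inj h H by blast
      qed
    qed
  qed
qed

lemma Phi_pow:
  assumes "k \<in> {0..int m - 2}"
  shows "\<Phi> k (t [^] i) = (int i * \<Phi> k t) mod int m"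
proof (induction i)
  case 0
  show ?case
    using Phi_one[of k] assms by (simp add: mem_Z)
next
  case (Suc i)
  have "\<Phi> k (t [^] Suc i) = (\<Phi> k (t [^] i) + \<Phi> k t) mod int m"
    using assms Phi_mult[of "t [^] i" t k] generator(1) by (simp add: mem_Z)
  then show ?case
    using Suc by (simp add: mod_simps algebra_simps)
qed

lemma iso_if_coprime:
  assumes k: "k \<in> {0..int m - 2}" and coprime: "coprime (\<Phi> k t) (int m)"
  shows "\<Phi> k \<in> iso G Z"
proof -
  have "carrier Z \<subseteq> \<Phi> k ` carrier G"
  proof
    fix y assume y: "y \<in> carrier Z"
    obtain b c where "b * \<Phi> k t + c * int m = 1"
      using bezout_int[of "\<Phi> k t" "int m"] coprime by auto
    then have inverse: "\<Phi> k t * b = 1 - c * int m"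
      by (simp add: algebra_simps)
    have "(\<Phi> k t * b * y) mod int m = (y - (c * y) * int m) mod int m"
      unfolding inverse by (simp add: algebra_simps)
    then have b: "(\<Phi> k t * b * y) mod int m = y mod int m"
      by (simp add: mod_diff_right_eq[symmetric])
    let ?i = "nat ((b * y) mod int m)"
    have "int ?i = (b * y) mod int m"
      using m_ge_2 by simp
    then have "\<Phi> k (t [^] ?i) = (\<Phi> k t * b * y) mod int m"
      using Phi_pow[OF k, of ?i] by (simp add: mod_simps mult_ac)
    also have "\<dots> = y mod int m"
      by (rule b)
    also have "\<dots> = y"
      using y by (simp add: mem_Z)
    finally show "y \<in> \<Phi> k ` carrier G"
      using nat_pow_closed[OF generator(1)] by (metis imageI)
  qed
  then have img: "\<Phi> k ` carrier G = carrier Z"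
    using Phi_hom[OF k] by (auto simp: hom_def)
  have "card (carrier Z) = card (carrier G)" "finite (carrier G)"
    using order_G m_ge_2 by (auto simp: order_def carrier_integer_mod_group intro: card_ge_0_finite)
  then have "inj_on (\<Phi> k) (carrier G)"
    using img by (intro eq_card_imp_inj_on) auto
  then show ?thesis
    using Phi_hom[OF k] img by (simp add: iso_def bij_betw_def)
qed

end

section \<open>Failure of simplicity\<close>

text \<open>The subsets with and without \<open>q\<close> cancel in pairs.\<close>

lemma alternating_sum_Pow_eq_zero:
  fixes f :: "'a set \<Rightarrow> 'k::comm_ring_1"
  assumes "finite P" "q \<in> P" and eq: "\<And>T. T \<subseteq> P - {q} \<Longrightarrow> f (insert q T) = f T"
  shows "(\<Sum>T\<in>Pow P. (- 1) ^ card T * f T) = 0"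
proof -
  let ?Q = "P - {q}"
  have fin: "finite ?Q" and P: "P = insert q ?Q"
    using assms by auto
  have "(\<Sum>T\<in>Pow P. (- 1) ^ card T * f T) =
      (\<Sum>T\<in>Pow ?Q. (- 1) ^ card T * f T) + (\<Sum>T\<in>insert q ` Pow ?Q. (- 1) ^ card T * f T)"
    by (subst P, subst Pow_insert, rule sum.union_disjoint) (use fin in auto)
  also have "(\<Sum>T\<in>insert q ` Pow ?Q. (- 1) ^ card T * f T) =
      (\<Sum>T\<in>Pow ?Q. (- 1) ^ card (insert q T) * f (insert q T))"
    by (rule sum.reindex_cong[where l = "insert q"]) (auto simp: inj_on_def)
  also have "\<dots> = (\<Sum>T\<in>Pow ?Q. - ((- 1) ^ card T * f T))"
  proof (rule sum.cong[OF refl])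
    fix T assume "T \<in> Pow ?Q"
    then have "q \<notin> T" "finite T" "T \<subseteq> ?Q"
      using fin finite_subset by auto
    then show "(- 1) ^ card (insert q T) * f (insert q T) = - ((- 1) ^ card T * f T)"
      by (simp add: eq)
  qed
  finally show ?thesis
    by (simp add: sum_negf)
qed

text \<open>
  For \<open>q \<in> T\<close>, the power of \<open>q\<close> in \<open>m\<close> divides all summands except \<open>m div q\<close>. In the group, this means
  that a nonempty product of elements \<open>t\<^bsup>m/p\<^esup>\<close> of distinct prime orders is nontrivial.
\<close>

lemma not_dvd_sum_quotients:
  fixes m :: nat
  assumes "m > 0" "T \<subseteq> prime_factors m" "T \<noteq> {}"
  shows "\<not> m dvd (\<Sum>p\<in>T. m div p)"
proof
  assume dvd: "m dvd (\<Sum>p\<in>T. m div p)"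
  obtain q where q: "q \<in> T"
    using assms(3) by blast
  have fin: "finite T"
    using assms(2) finite_subset by blast
  have T: "Factorial_Ring.prime p" "p dvd m" if "p \<in> T" for p
    using that assms(2) by (auto simp: in_prime_factors_iff)
  define e where "e = q ^ multiplicity q m"
  have "e dvd m"
    unfolding e_def by (rule multiplicity_dvd)
  have "e dvd m div p" if p: "p \<in> T - {q}" for p
  proof -
    have "coprime q p"
      using p T q by (intro primes_coprime) auto
    then have "coprime e p"
      unfolding e_def by simp
    moreover have "e dvd p * (m div p)"
      using \<open>e dvd m\<close> p T(2)[of p] by simp
    ultimately show ?thesis
      by (simp add: coprime_dvd_mult_right_iff)
  qed
  then have "e dvd (\<Sum>p\<in>T - {q}. m div p)"
    by (rule dvd_sum)
  moreover have "e dvd m div q + (\<Sum>p\<in>T - {q}. m div p)"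
    using \<open>e dvd m\<close> dvd sum.remove[OF fin q, of "\<lambda>p. m div p"] by (metis dvd_trans)
  ultimately have "e dvd m div q"
    by (simp add: dvd_add_left_iff)
  then have "q * e dvd q * (m div q)"
    by simp
  then have "q ^ Suc (multiplicity q m) dvd m"
    using T(2)[OF q] by (simp add: e_def)
  moreover have "\<not> is_unit q" "m \<noteq> 0"
    using T(1)[OF q] assms(1) by (auto simp: Factorial_Ring.not_prime_unit)
  ultimately show False
    using multiplicity_geI[of m q "Suc (multiplicity q m)"] by auto
qed

lemma split_at_first_other:
  assumes "y \<in> set v" "y \<noteq> c"
  obtains j k r where "v = replicate j c @ k # r" "k \<noteq> c"
proof -
  have "\<exists>j k r. v = replicate j c @ k # r \<and> k \<noteq> c"
    using assms
  proof (induction v)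
    case (Cons x v)
    show ?case
    proof (cases "x = c")
      case True
      then obtain j k r where "v = replicate j c @ k # r" "k \<noteq> c"
        using Cons by auto
      then show ?thesis
        using True by (intro exI[of _ "Suc j"]) auto
    next
      case False
      then show ?thesis
        by (intro exI[of _ 0] exI[of _ x] exI[of _ v]) auto
    qed
  qed simp
  then show ?thesis
    using that by blast
qed

context ggs_data
begin

definition torsion_exponent :: "nat set \<Rightarrow> nat" where
  "torsion_exponent T = (\<Sum>p\<in>T. m div p)"

abbreviation torsion_perm :: "nat set \<Rightarrow> int list \<Rightarrow> int list" where
  "torsion_perm T \<equiv> perm_of_G (t [^] torsion_exponent T)"

text \<open>
  The product of the elements \<open>1 - t\<^bsup>m/p\<^esup>\<close> over all primes \<open>p\<close> dividing \<open>m\<close>, expanded.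
\<close>

definition singular_element :: "(int nek_gen, 'k::field) free_star" where
  "singular_element = (\<Sum>T\<in>Pow (prime_factors m).
     Poly_Mapping.single [Plain (Elem (torsion_perm T))] ((- 1) ^ card T))"

lemma torsion_perm_in: "torsion_perm T \<in> ggs_group G m \<Phi>"
  using perm_of_G_in_gens[OF nat_pow_closed[OF generator(1)]] gens_in_ggs by blast

lemma singular_element_in: "singular_element \<in> carrier ssg.F"
  unfolding singular_element_def by (intro ssg.sum_in_F ssg.single_in_F) (simp add: torsion_perm_in)

lemma linear_ext_singular_element:
  "linear_ext \<phi> singular_element =
    (\<Sum>T\<in>Pow (prime_factors m). (- 1) ^ card T * \<phi> [Plain (Elem (torsion_perm T))])"
  unfolding singular_element_def linear_ext_sum linear_ext_single ..

text \<open>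
  The action of \<open>G\<close> passes along an initial run of the letter \<open>m - 1\<close> and becomes an action of \<open>H\<close>
  behind the first other letter.
\<close>

lemma act_G_replicate_last:
  "k \<noteq> int m - 1 \<Longrightarrow> act_G m \<Phi> g (replicate j (int m - 1) @ k # w) =
    replicate j (int m - 1) @ k # act_H m (\<Phi> k g) w"
  by (induction j) auto

lemma exists_Phi_torsion_nonzero:
  assumes "\<not> m dvd i"
  shows "\<exists>k\<in>{0..int m - 2}. \<Phi> k (t [^] i) \<noteq> 0"
proof (rule ccontr)
  assume "\<not> ?thesis"
  then have "(int i * \<Phi> k t) mod int m = 0" if "k \<in> {0..int m - 2}" for k
    using that Phi_pow[OF that] by metis
  then have "int m dvd Gcd ((*) (int i) ` insert (int m) ((\<lambda>k. \<Phi> k t) ` {0..int m - 2}))"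
    by (intro Gcd_greatest) (auto simp: dvd_eq_mod_eq_0)
  then have "int m dvd int i"
    by (simp only: Gcd_mult gcd_1) simp
  then show False
    using assms by simp
qed

text \<open>
  A nontrivial \<open>g \<in> G\<close> has \<open>\<Phi> k g \<noteq> 0\<close> for some \<open>k\<close>, hence moves \<open>(m-1)\<^sup>n k 0\<close> for all \<open>n\<close>.
\<close>

lemma germ_functional_torsion_perm:
  assumes T: "T \<subseteq> prime_factors m"
  shows "ssg.germ_functional (int m - 1) [Plain (Elem (torsion_perm T))] = (if T = {} then 1 else 0)"
proof (cases "T = {}")
  case True
  then have "torsion_perm T = \<one>\<^bsub>BijGroup W\<^esub>"
    by (simp add: torsion_exponent_def perm_of_one)
  then have "ssg.word_act [Plain (Elem (torsion_perm T))] (replicate 0 (int m - 1) @ w) =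
      Some (replicate 0 (int m - 1) @ w)" if "w \<in> W" for w
    using ssg.one_apply[OF that] by simp
  with True show ?thesis
    unfolding ssg.germ_functional_def by metis
next
  case False
  then have "\<not> m dvd torsion_exponent T"
    unfolding torsion_exponent_def using T m_ge_2 by (intro not_dvd_sum_quotients) auto
  then obtain k where k: "k \<in> {0..int m - 2}" and nz: "\<Phi> k (t [^] torsion_exponent T) \<noteq> 0"
    using exists_Phi_torsion_nonzero by blast
  let ?g = "t [^] torsion_exponent T"
  have k': "k \<in> carrier Z" "k \<noteq> int m - 1" and Z: "0 \<in> carrier Z" "int m - 1 \<in> carrier Z"
    using k m_ge_2 by (auto simp: mem_Z)
  have g: "?g \<in> carrier G"
    by (rule nat_pow_closed[OF generator(1)])
  have "ssg.word_act [Plain (Elem (torsion_perm T))] (replicate n (int m - 1) @ [k, 0]) \<noteq>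
      Some (replicate n (int m - 1) @ [k, 0])" for n
  proof -
    have "replicate n (int m - 1) @ [k, 0] \<in> W"
      using k' Z by auto
    then have "ssg.word_act [Plain (Elem (torsion_perm T))] (replicate n (int m - 1) @ [k, 0]) =
        Some (replicate n (int m - 1) @ [k, \<Phi> k ?g])"
      using act_G_replicate_last[OF k'(2), of ?g n "[0]"] Phi_closed[OF g k'] by (simp add: mem_Z)
    then show ?thesis
      using nz by simp
  qed
  moreover have "[k, 0] \<in> W"
    using k' Z by simp
  ultimately show ?thesis
    using False unfolding ssg.germ_functional_def by metis
qed

lemma singular_element_notin_germ_ideal:
  "(singular_element :: (int nek_gen, 'k::field) free_star) \<notin> ssg.germ_ideal TYPE('k) (int m - 1)"
proof
  assume "(singular_element :: (int nek_gen, 'k) free_star) \<in> ssg.germ_ideal TYPE('k) (int m - 1)"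
  then have "linear_ext (\<lambda>u. ssg.germ_functional (int m - 1) ([] @ u @ []))
      (singular_element :: (int nek_gen, 'k) free_star) = 0"
    unfolding ssg.mem_germ_ideal_iff by (blast intro: lists.Nil)
  moreover have "linear_ext (\<lambda>u. ssg.germ_functional (int m - 1) ([] @ u @ []))
      (singular_element :: (int nek_gen, 'k) free_star) =
      (\<Sum>T\<in>Pow (prime_factors m). if T = {} then 1 else 0)"
    unfolding linear_ext_singular_element
    by (rule sum.cong[OF refl]) (auto simp: germ_functional_torsion_perm)
  ultimately show False
    by simp
qed

text \<open>
  As \<open>0 \<noteq> m - 1\<close>, the sections of generators at \<open>0 0\<close> are trivial. By contraction, all elements thus
  fix the letters of \<open>0\<^sup>\<infinity>\<close> from some point on.
\<close>

lemma ggs_image_of_zeros_contains_zero: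
  assumes f: "f \<in> ggs_group G m \<Phi>"
  shows "\<exists>n. 0 \<in> set (f (replicate n 0))"
proof -
  have zero: "0 \<in> carrier Z" "(0::int) \<noteq> int m - 1"
    using m_ge_2 by (auto simp: mem_Z)
  have rep: "replicate n 0 \<in> W" for n
    using zero by auto
  obtain n where n: "ssg.word_section f (replicate n 0) \<in> gens"
    using ggs_contracting[OF f] rep by (metis length_replicate order_refl)
  let ?h = "ssg.word_section f (replicate n 0)"
  have "group_section (carrier Z) (ggs_group G m \<Phi>) (group_section (carrier Z) (ggs_group G m \<Phi>) ?h 0) 0 =
      \<one>\<^bsub>BijGroup W\<^esub>"
    using n
  proof (cases ?h rule: gens_cases)
    case (G g)
    then show ?thesis
      using group_section_perm_of_G[OF G(1) zero(1)]
        group_section_perm_of_H[OF Phi_closed[OF G(1) zero] zero(1)] zero(2) by simp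
  next
    case (H h)
    then show ?thesis
      using group_section_perm_of_H[OF H(1) zero(1)] group_section_perm_of_H[OF zero(1) zero(1)]
      by (simp only: perm_of_one)
  qed
  then have "ssg.word_section f (replicate n 0 @ [0, 0]) = \<one>\<^bsub>BijGroup W\<^esub>"
    by (simp add: ssg.word_section_append)
  then have "f ((replicate n 0 @ [0, 0]) @ [0]) = f (replicate n 0 @ [0, 0]) @ [0]"
    using ssg.word_section_apply[OF f, of "replicate n 0 @ [0, 0]" "[0]"] zero(1) rep[of n]
      ssg.one_apply[of "[0]"] by (simp del: append_assoc)
  moreover have "(replicate n 0 @ [0, 0]) @ [0] = replicate (n + 3) (0::int)"
    unfolding replicate_add by (simp add: numeral_3_eq_3)
  ultimately show ?thesis
    by (metis in_set_conv_decomp)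
qed

text \<open>
  Near \<open>0\<^sup>\<infinity>\<close>, the images under a word of generators start with a common word containing \<open>0\<close>, hence a
  letter other than \<open>m - 1\<close>. If \<open>k\<close> is the first such letter, then an element \<open>g\<close> of \<open>G\<close> acts on these
  images through \<open>\<Phi> k g\<close>. For a prime \<open>q\<close> dividing \<open>m\<close> and \<open>e\<^sub>k\<close>, this value does not change when \<open>g\<close>
  is multiplied by \<open>t\<^bsup>m/q\<^esup>\<close>, so that the terms of \<open>a\<close> cancel in pairs.
\<close>

lemma singular_element_in_germ_ideal:
  assumes not_coprime: "\<And>k. k \<in> {0..int m - 2} \<Longrightarrow> \<not> coprime (\<Phi> k t) (int m)"
  shows "(singular_element :: (int nek_gen, 'k::field) free_star) \<in> ssg.germ_ideal TYPE('k) 0"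
proof -
  have zero: "0 \<in> carrier Z" "(0::int) \<noteq> int m - 1"
    using m_ge_2 by (auto simp: mem_Z)
  have "linear_ext (\<lambda>u. ssg.germ_functional 0 (v @ u @ w)) (singular_element :: (int nek_gen, 'k) free_star) = 0"
    if v: "v \<in> lists ssg.alphabet" and w: "w \<in> lists ssg.alphabet" for v w
  proof -
    obtain n where "(\<forall>u\<in>W. ssg.word_act w (replicate n 0 @ u) = None) \<or>
        (\<exists>x\<in>W. \<exists>g\<in>ggs_group G m \<Phi>. \<forall>u\<in>W. ssg.word_act w (replicate n 0 @ u) = Some (x @ g u))"
      using ssg.word_germ[OF w zero(1)] by blast
    then consider "\<And>u. u \<in> W \<Longrightarrow> ssg.word_act w (replicate n 0 @ u) = None"
      | x f where "x \<in> W" "f \<in> ggs_group G m \<Phi>"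
        "\<And>u. u \<in> W \<Longrightarrow> ssg.word_act w (replicate n 0 @ u) = Some (x @ f u)"
      by blast
    then show ?thesis
    proof cases
      case 1
      have "ssg.germ_functional 0 (v @ s @ w) = (0 :: 'k)" for s
        by (rule ssg.germ_functional_eq_zero[OF zero(1), where n = n])
          (simp add: ssg.word_act_append 1 del: in_lists_conv_set)
      then show ?thesis
        by (simp only: linear_ext_singular_element mult_zero_right sum.neutral_const)
    next
      case (2 x f)
      obtain n' where n': "0 \<in> set (f (replicate n' 0))"
        using ggs_image_of_zeros_contains_zero[OF 2(2)] by blast
      let ?x = "x @ f (replicate n' 0)"
      have rep: "replicate n' 0 \<in> W"
        using zero by auto
      have "0 \<in> set ?x"
        using n' by simp
      then obtain j k r where x_split: "?x = replicate j (int m - 1) @ k # r" and k: "k \<noteq> int m - 1"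
        by (rule split_at_first_other[OF _ zero(2)])
      have x_in: "?x \<in> W"
        using 2(1) ssg.perm_closed[OF 2(2) rep] by simp
      then have "k \<in> carrier Z"
        unfolding x_split by simp
      then have k_in: "k \<in> {0..int m - 2}"
        using k by (auto simp: mem_Z)
      obtain q where q: "Factorial_Ring.prime q" "q dvd m" "int q dvd \<Phi> k t"
      proof -
        let ?d = "nat (gcd (\<Phi> k t) (int m))"
        have "?d \<noteq> 1"
          using not_coprime[OF k_in] by (simp add: coprime_iff_gcd_eq_1 nat_eq_iff)
        then obtain q where "Factorial_Ring.prime q" "q dvd ?d"
          using prime_factor_nat by blast
        moreover from this(2) have "int q dvd gcd (\<Phi> k t) (int m)"
          by (metis gcd_ge_0_int int_dvd_int_iff int_nat_eq)
        ultimately show ?thesis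
          using that[of q] by simp
      qed
      show ?thesis
        unfolding linear_ext_singular_element
      proof (rule alternating_sum_Pow_eq_zero)
        show "q \<in> prime_factors m"
          using q m_ge_2 by (auto simp: in_prime_factors_iff)
        fix T assume T: "T \<subseteq> prime_factors m - {q}"
        have fin: "finite T" "q \<notin> T"
          using T finite_subset by auto
        have "int m dvd int (m div q) * \<Phi> k t"
        proof -
          have "int m = int (m div q) * int q"
            using q(2) by (metis dvd_div_mult_self of_nat_mult)
          then show ?thesis
            using q(3) by (metis dvd_refl mult_dvd_mono)
        qed
        then have "(int (torsion_exponent (insert q T)) * \<Phi> k t) mod int m =
            (int (torsion_exponent T) * \<Phi> k t) mod int m"
          using fin by (simp add: torsion_exponent_def distrib_right mod_add_eq[symmetric] mod_eq_0_iff_dvd[THEN iffD2])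
        then have Phi_eq: "\<Phi> k (t [^] torsion_exponent (insert q T)) = \<Phi> k (t [^] torsion_exponent T)"
          by (simp add: Phi_pow[OF k_in])
        have perm_eq: "torsion_perm (insert q T) (?x @ u) = torsion_perm T (?x @ u)" if "u \<in> W" for u
          using x_in that act_G_replicate_last[OF k] Phi_eq unfolding x_split by simp
        have act_w: "ssg.word_act w (replicate (n + n') 0 @ u) =
            Some (?x @ ssg.word_section f (replicate n' 0) u)" if "u \<in> W" for u
          using ssg.word_germ_extend[OF zero(1) 2 that, of n'] by simp
        show "ssg.germ_functional 0 (v @ [Plain (Elem (torsion_perm (insert q T)))] @ w) =
            (ssg.germ_functional 0 (v @ [Plain (Elem (torsion_perm T))] @ w) :: 'k)"
        proof (rule ssg.germ_functional_cong[OF zero(1), where n = "n + n'"])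
          fix u assume u: "u \<in> W"
          have "ssg.word_section f (replicate n' 0) u \<in> W"
            by (rule ssg.perm_closed[OF ssg.word_section_in[OF 2(2) rep] u])
          note eq = perm_eq[OF this]
          show
            "ssg.word_act (v @ [Plain (Elem (torsion_perm (insert q T)))] @ w) (replicate (n + n') 0 @ u) =
              ssg.word_act (v @ [Plain (Elem (torsion_perm T))] @ w) (replicate (n + n') 0 @ u)"
            unfolding ssg.word_act_append act_w[OF u] ssg.word_act.simps
            unfolding Option.bind.simps ssg.word_act.simps ssg.letter_act.simps eq ..
        qed
      qed simp
    qed
  qed
  then show ?thesis
    unfolding ssg.mem_germ_ideal_iff using singular_element_in by blast
qed

lemma not_simple_if_not_coprime:
  assumes "\<And>k. k \<in> {0..int m - 2} \<Longrightarrow> \<not> coprime (\<Phi> k t) (int m)"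
  shows "\<not> simple_ring (nekrashevych_algebra TYPE('k::field) (carrier Z) (ggs_group G m \<Phi>))"
proof
  let ?a = "singular_element :: (int nek_gen, 'k) free_star"
  let ?J = "ssg.germ_ideal TYPE('k) 0"
  have Z: "0 \<in> carrier Z" "int m - 1 \<in> carrier Z"
    using m_ge_2 by (auto simp: mem_Z)
  have "?a \<notin> ssg.I"
    using singular_element_notin_germ_ideal ssg.relator_ideal_subset_germ_ideal[OF Z(2)] by blast
  moreover have "?a \<in> ?J"
    by (rule singular_element_in_germ_ideal[OF assms])
  ultimately have "ssg.I \<subset> ?J"
    using ssg.relator_ideal_subset_germ_ideal[OF Z(1)] by blast
  moreover assume "simple_ring (nekrashevych_algebra TYPE('k) (carrier Z) (ggs_group G m \<Phi>))"
  ultimately have "1 \<in> ?J"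
    unfolding ssg.simple_nekrashevych_algebra_iff using ideal_functional_ideal by blast
  then show False
    using ssg.one_notin_germ_ideal by blast
qed

lemma primepow_coprime:
  assumes "primepow m"
  shows "\<exists>k\<in>{0..int m - 2}. coprime (\<Phi> k t) (int m)"
proof (rule ccontr)
  assume not_coprime: "\<not> ?thesis"
  obtain p r where p: "Factorial_Ring.prime p" "r > 0" "m = p ^ r"
    using assms by (auto simp: primepow_def)
  have "int p dvd \<Phi> k t" if "k \<in> {0..int m - 2}" for k
  proof (rule ccontr)
    assume "\<not> int p dvd \<Phi> k t"
    then have "coprime (int p) (\<Phi> k t)"
      using p(1) by (intro prime_imp_coprime) auto
    then have "coprime (\<Phi> k t) (int m)"
      using p by (simp add: coprime_commute)
    then show False
      using not_coprime that by blast
  qed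
  then have "int p dvd Gcd (insert (int m) ((\<lambda>k. \<Phi> k t) ` {0..int m - 2}))"
    using p by (intro Gcd_greatest) (auto intro: dvd_power)
  then show False
    using p(1) by (simp only: gcd_1) auto
qed

end

theorem theorem7p8:
  fixes G :: "('g, 'b) monoid_scheme" and m :: nat and t :: 'g and \<Phi> :: "int \<Rightarrow> 'g \<Rightarrow> int"
  assumes "ggs_data G m t \<Phi>"
  shows "let N = nekrashevych_algebra TYPE('k::field) (carrier (integer_mod_group m)) (ggs_group G m \<Phi>)
    in ((\<exists>k \<in> {0..int m - 2}. \<Phi> k \<in> iso G (integer_mod_group m)) \<longrightarrow> simple_ring N)
     \<and> (\<not> (\<exists>k \<in> {0..int m - 2}. \<Phi> k \<in> iso G (integer_mod_group m)) \<longrightarrow> \<not> simple_ring N)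
     \<and> (primepow m \<longrightarrow> simple_ring N)
     \<and> (gupta_sidki_data m t \<Phi> \<longrightarrow> simple_ring N)"
proof -
  interpret ggs_data G m t \<Phi>
    by (rule assms)
  let ?N = "nekrashevych_algebra TYPE('k) (carrier Z) (ggs_group G m \<Phi>)"
  have iso: "simple_ring ?N" if "\<exists>k \<in> {0..int m - 2}. \<Phi> k \<in> iso G Z"
    using that simple_if_iso by blast
  have not_iso: "\<not> simple_ring ?N" if "\<not> (\<exists>k \<in> {0..int m - 2}. \<Phi> k \<in> iso G Z)"
    using that iso_if_coprime not_simple_if_not_coprime by blast
  have primepow: "simple_ring ?N" if "primepow m"
    using primepow_coprime[OF that] iso_if_coprime iso by blast
  have "simple_ring ?N" if "gupta_sidki_data m t \<Phi>"
    using that by (intro primepow primepow_prime) (simp add: gupta_sidki_data_def)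
  with iso not_iso primepow show ?thesis
    unfolding Let_def by blast
qed

end
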